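(* Let $K$ be a field of characteristic zero, not necessarily algebraically closed, and let $I = (F_1,F_2,F_3) \subset R = K[x_1,x_2,x_3]$ be a height three Artinian complete intersection, i.e. $F_1,F_2,F_3$ is a regular sequence of homogeneous polynomials of positive degrees. Then $R/I$ has the Weak Lefschetz property.
   Context: $K[x_1,x_2,x_3]$ has the standard grading. A standard graded Artinian $K$-algebra $A = \bigoplus_{i\ge 0} A_i$ has the Weak Lefschetz property if there is an element $\ell \in A_1$ such that for every $i \ge 0$ the multiplication map $\times \ell : A_i \to A_{i+1}$ has maximal rank (i.e. is injective or surjective). *)

theory Defs
  imports
    "HOL-Library.Poly_Mapping"
    "HOL-Library.Numeral_Type"
    "HOL-Algebra.QuotRing"
    "HOL-Algebra.Algebraic_Closure_Type"
begin

text \<open>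
  Polynomials over \<open>'k\<close> in three variables, the variables being indexed by the three-element
  type \<open>3\<close>: a polynomial is a finitely supported map from exponent vectors to coefficients.
\<close>

type_synonym 'k poly3 = "(3 \<Rightarrow>\<^sub>0 nat) \<Rightarrow>\<^sub>0 'k"

abbreviation poly3_ring :: "'k::field_char_0 poly3 ring" where
  "poly3_ring \<equiv> ring_of_type_algebra"

definition total_degree :: "(3 \<Rightarrow>\<^sub>0 nat) \<Rightarrow> nat" where
  "total_degree m = (\<Sum>v\<in>UNIV. Poly_Mapping.lookup m v)"

text \<open>The zero polynomial lies in \<open>forms d\<close> for every \<open>d\<close>.\<close>

definition forms :: "nat \<Rightarrow> 'k::field_char_0 poly3 set" where
  "forms d = {p. \<forall>m\<in>Poly_Mapping.keys p. total_degree m = d}"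

text \<open>
  Each \<open>fs ! i\<close> is a nonzerodivisor modulo the ideal generated by its predecessors, and the
  ideal generated by the whole sequence is proper.
\<close>

definition regular_sequence :: "('a, 'm) ring_scheme \<Rightarrow> 'a list \<Rightarrow> bool" where
  "regular_sequence R fs \<longleftrightarrow>
     set fs \<subseteq> carrier R \<and>
     (\<forall>i<length fs. \<forall>g\<in>carrier R.
        fs ! i \<otimes>\<^bsub>R\<^esub> g \<in> Idl\<^bsub>R\<^esub> (set (take i fs)) \<longrightarrow> g \<in> Idl\<^bsub>R\<^esub> (set (take i fs))) \<and>
     Idl\<^bsub>R\<^esub> (set fs) \<noteq> carrier R"

text \<open>The component of degree \<open>d\<close> of the quotient by \<open>I\<close>, i.e. the image of the forms of degree
  \<open>d\<close>; it gives a grading of the quotient when \<open>I\<close> is a homogeneous ideal.\<close>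

definition quot_component :: "'k::field_char_0 poly3 set \<Rightarrow> nat \<Rightarrow> 'k poly3 set set" where
  "quot_component I d = (\<lambda>p. I +>\<^bsub>poly3_ring\<^esub> p) ` forms d"

text \<open>\<open>A\<close> is meant to be a standard graded Artinian algebra with homogeneous components \<open>G i\<close>.\<close>

definition weak_lefschetz_property :: "('a, 'm) ring_scheme \<Rightarrow> (nat \<Rightarrow> 'a set) \<Rightarrow> bool" where
  "weak_lefschetz_property A G \<longleftrightarrow>
     (\<exists>l\<in>G 1. \<forall>i. inj_on (\<lambda>a. l \<otimes>\<^bsub>A\<^esub> a) (G i) \<or> (\<lambda>a. l \<otimes>\<^bsub>A\<^esub> a) ` G i = G (i + 1))"

end

theory Submission
  imports Defs
    "Berlekamp_Zassenhaus.Unique_Factorization_Poly"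
    "Jordan_Normal_Form.Determinant"
begin

text \<open>
  Let \<open>f\<^sub>i = F\<^sub>i(x, 1, u x + v)\<close> be the restrictions to the generic line \<open>z = u x + v y\<close> and let \<open>a\<close> be half
  the sum of the degrees (made even, if necessary, by multiplying \<open>F3\<close> with a linear form). If all
  degrees are at most \<open>a\<close>, then multiplication by the form of the line has maximal rank in all degrees as
  soon as the square linear map \<open>(g\<^sub>i) \<mapsto> \<Sum> g\<^sub>i f\<^sub>i\<close> with \<open>deg (g\<^sub>i f\<^sub>i) < a\<close> is bijective. Otherwise it
  has a kernel element \<open>g\<close> over \<open>K[u, v]\<close>. The derivation \<open>D = \<partial>\<^sub>u - x \<partial>\<^sub>v\<close> kills the \<open>f\<^sub>i\<close>, so \<open>D g\<close> is
  another syzygy, of \<open>x\<close>-degree at most one more. The cross product of \<open>g\<close> and \<open>D g\<close> is a multiple of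
  \<open>(f\<^sub>1, f\<^sub>2, f\<^sub>3)\<close> by coprimality, and vanishes by degree reasons. Hence, after division by common factors,
  \<open>g\<^sub>i\<close> divides \<open>D g\<^sub>i\<close>, which forces \<open>D g = 0\<close>: the syzygy \<open>g\<close> descends to a syzygy of
  \<open>F1, F2, F3\<close> in a degree in which regular sequences have none. If one degree exceeds the sum of the two
  others, the same argument is applied to the two forms of smaller degree. This is an elementary form of
  the Grauert-Muelich argument for the syzygy bundle.
\<close>

hide_const (open) Polynomials.degree

section \<open>Ring homomorphisms and two coordinate systems\<close>

declare pCons_one [simp del]

text \<open>Here \<open>h\<close> is a gcd of the triple. Primitivity is kept in a multiplicative
  form, because the descent has to cancel \<open>q1\<close>, \<open>q2\<close>, \<open>q3\<close>
  from divisibilities such as \<open>q1 dvd q2 * pderiv q1\<close>.\<close>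

lemma primitive_triple:
  fixes p1 p2 p3 :: "'a::ufd"
  assumes "p1 \<noteq> 0 \<or> p2 \<noteq> 0 \<or> p3 \<noteq> 0"
  obtains h q1 q2 q3 where "h \<noteq> 0" "p1 = h * q1" "p2 = h * q2" "p3 = h * q3"
    "\<And>a b. a dvd q1 * b \<Longrightarrow> a dvd q2 * b \<Longrightarrow> a dvd q3 * b \<Longrightarrow> a dvd b"
proof -
  define h where "h = some_gcd.listgcd [p1, p2, p3]"
  have d: "h dvd p1" "h dvd p2" "h dvd p3"
    unfolding h_def by (rule some_gcd.listgcd; simp)+
  then obtain q1 q2 q3 where q: "p1 = h * q1" "p2 = h * q2" "p3 = h * q3"
    unfolding dvd_def by blast
  have h0: "h \<noteq> 0" using assms q by auto
  have "a dvd b" if "a dvd q1 * b" "a dvd q2 * b" "a dvd q3 * b" for a b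
  proof -
    have "h * a dvd some_gcd.listgcd [p1, p2, p3] * b"
    proof (rule some_gcd.listgcd_greatest_mult)
      fix x assume "x \<in> set [p1, p2, p3]"
      then have "x \<in> {h * q1, h * q2, h * q3}" by (simp add: q)
      then show "h * a dvd x * b" using that h0 by (auto simp: mult.assoc dvd_times_left_cancel_iff)
    qed
    then have "h * a dvd h * b" by (simp only: h_def)
    then show ?thesis using h0 by (rule dvd_times_left_cancel_iff[THEN iffD1, rotated])
  qed
  then show thesis using that[OF h0 q] by blast
qed


lemma comm_ring_hom_eval:
  assumes "comm_ring_hom h"
  shows "comm_ring_hom (\<lambda>p. poly (map_poly h p) a)"
proof -
  interpret h: comm_ring_hom h by fact
  interpret m: map_poly_comm_ring_hom h ..
  show ?thesis by unfold_locales (simp_all add: m.hom_add m.hom_mult)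
qed

lemma comm_ring_hom_map_poly:
  assumes "comm_ring_hom h"
  shows "comm_ring_hom (map_poly h)"
proof -
  interpret h: comm_ring_hom h by fact
  interpret m: map_poly_comm_ring_hom h ..
  show ?thesis by unfold_locales
qed

lemma comm_ring_hom_comp:
  assumes "comm_ring_hom f" "comm_ring_hom g"
  shows "comm_ring_hom (\<lambda>x. f (g x))"
proof -
  interpret f: comm_ring_hom f by fact
  interpret g: comm_ring_hom g by fact
  show ?thesis by unfold_locales (simp_all add: f.hom_add f.hom_mult g.hom_add g.hom_mult)
qed

lemma comm_ring_hom_const: "comm_ring_hom (\<lambda>c::'a::comm_ring_1. [:c:])"
  by unfold_locales (simp_all add: pCons_one)

lemma comm_ring_hom_id: "comm_ring_hom (\<lambda>x::'a::comm_ring_1. x)"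
  by unfold_locales simp_all

lemma poly_hom_eqI:
  fixes f g :: "'a::comm_ring_1 poly \<Rightarrow> 'b::comm_ring_1"
  assumes "comm_ring_hom f" "comm_ring_hom g"
    and "\<And>c. f [:c:] = g [:c:]" "f [:0, 1:] = g [:0, 1:]"
  shows "f p = g p"
proof -
  interpret f: comm_ring_hom f by fact
  interpret g: comm_ring_hom g by fact
  show ?thesis
  proof (induction p)
    case 0
    then show ?case by simp
  next
    case (pCons a p)
    have e: "pCons a p = [:a:] + [:0, 1:] * p" by simp
    show ?case unfolding e by (simp only: f.hom_add f.hom_mult g.hom_add g.hom_mult assms pCons.IH)
  qed
qed


text \<open>
  Nested univariate polynomials are read in two ways: the source of \<open>subst3\<close> is \<open>K[x][z][u]\<close>, where the
  restrictions of the \<open>F\<^sub>i\<close> are constant in the outermost variable \<open>u\<close> and \<open>D\<close> is \<open>pderiv\<close>; its target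
  is \<open>K[u][v][x]\<close>, where the degree in \<open>x\<close> is \<open>degree\<close>. The isomorphism \<open>subst3\<close> sends \<open>z\<close> to
  \<open>u x + v\<close>, its inverse \<open>back3\<close> sends \<open>v\<close> to \<open>z - u x\<close>.
\<close>

definition lift_coeff :: "'k::comm_ring_1 poly \<Rightarrow> 'k::comm_ring_1 poly poly poly" where
  "lift_coeff = map_poly (\<lambda>c. [:[:c:]:])"

definition subst2 :: "'k::comm_ring_1 poly poly \<Rightarrow> 'k::comm_ring_1 poly poly poly" where
  "subst2 F = poly (map_poly lift_coeff F) [:[:0, 1:], [:[:0, 1:]:]:]"

definition subst3 :: "'k::comm_ring_1 poly poly poly \<Rightarrow> 'k::comm_ring_1 poly poly poly" where
  "subst3 p = poly (map_poly subst2 p) [:[:[:0, 1:]:]:]"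

text \<open>The same \<open>lift_coeff\<close> serves in both directions: it carries the innermost
  variable of its source to the outermost one of its target, which is \<open>x\<close> for
  \<open>subst2\<close> and \<open>u\<close> for \<open>back2\<close>.\<close>

definition back2 :: "'k::comm_ring_1 poly poly \<Rightarrow> 'k::comm_ring_1 poly poly poly" where
  "back2 c = poly (map_poly lift_coeff c) [:[:0, 1:], [:[:0, - 1:]:]:]"

definition back3 :: "'k::comm_ring_1 poly poly poly \<Rightarrow> 'k::comm_ring_1 poly poly poly" where
  "back3 q = poly (map_poly back2 q) [:[:[:0, 1:]:]:]"

lemma lift_coeff_hom: "comm_ring_hom lift_coeff"
  unfolding lift_coeff_def
  by (rule comm_ring_hom_map_poly[OF comm_ring_hom_comp[OF comm_ring_hom_const comm_ring_hom_const]])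

lemma subst2_hom: "comm_ring_hom subst2"
  unfolding subst2_def[abs_def] by (rule comm_ring_hom_eval[OF lift_coeff_hom])

lemma subst3_hom: "comm_ring_hom subst3"
  unfolding subst3_def[abs_def] by (rule comm_ring_hom_eval[OF subst2_hom])

lemma back2_hom: "comm_ring_hom back2"
  unfolding back2_def[abs_def] by (rule comm_ring_hom_eval[OF lift_coeff_hom])

lemma back3_hom: "comm_ring_hom back3"
  unfolding back3_def[abs_def] by (rule comm_ring_hom_eval[OF back2_hom])

lemma lift_coeff_uminus: "lift_coeff (- p) = - lift_coeff p"
proof -
  interpret l: comm_ring_hom lift_coeff by (rule lift_coeff_hom)
  show ?thesis by (rule l.hom_uminus)
qed

lemma lift_coeff_const: "lift_coeff [:c:] = [:[:[:c:]:]:]"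
  by (simp add: lift_coeff_def Polynomial.map_poly_pCons)

lemma lift_coeff_X: "lift_coeff [:0, 1:] = [:0, 1:]"
  by (simp add: lift_coeff_def Polynomial.map_poly_pCons)

lemma subst2_const: "subst2 [:r:] = lift_coeff r"
proof -
  interpret comm_ring_hom lift_coeff by (rule lift_coeff_hom)
  show ?thesis by (simp add: subst2_def Polynomial.map_poly_pCons)
qed

lemma subst2_X: "subst2 [:0, 1:] = [:[:0, 1:], [:[:0, 1:]:]:]"
proof -
  interpret comm_ring_hom lift_coeff by (rule lift_coeff_hom)
  show ?thesis by (simp add: subst2_def Polynomial.map_poly_pCons)
qed

lemma back2_const: "back2 [:r:] = lift_coeff r"
proof -
  interpret comm_ring_hom lift_coeff by (rule lift_coeff_hom)
  show ?thesis by (simp add: back2_def Polynomial.map_poly_pCons)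
qed

lemma back2_X: "back2 [:0, 1:] = [:[:0, 1:], [:[:0, - 1:]:]:]"
proof -
  interpret comm_ring_hom lift_coeff by (rule lift_coeff_hom)
  show ?thesis by (simp add: back2_def Polynomial.map_poly_pCons)
qed

lemma subst3_const: "subst3 [:F:] = subst2 F"
proof -
  interpret comm_ring_hom subst2 by (rule subst2_hom)
  show ?thesis by (simp add: subst3_def Polynomial.map_poly_pCons)
qed

lemma subst3_X: "subst3 [:0, 1:] = [:[:[:0, 1:]:]:]"
proof -
  interpret comm_ring_hom subst2 by (rule subst2_hom)
  show ?thesis by (simp add: subst3_def Polynomial.map_poly_pCons)
qed

lemma back3_const: "back3 [:c:] = back2 c"
proof -
  interpret comm_ring_hom back2 by (rule back2_hom)
  show ?thesis by (simp add: back3_def Polynomial.map_poly_pCons)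
qed

lemma back3_X: "back3 [:0, 1:] = [:[:[:0, 1:]:]:]"
proof -
  interpret comm_ring_hom back2 by (rule back2_hom)
  show ?thesis by (simp add: back3_def Polynomial.map_poly_pCons)
qed

lemmas coord_simps = lift_coeff_const lift_coeff_X subst2_const subst2_X back2_const back2_X
  subst3_const subst3_X back3_const back3_X

lemma hom3_eqI:
  fixes f g :: "'k::comm_ring_1 poly poly poly \<Rightarrow> 'b::comm_ring_1"
  assumes f: "comm_ring_hom f" and g: "comm_ring_hom g"
    and "\<And>c. f [:[:[:c:]:]:] = g [:[:[:c:]:]:]" "f [:[:[:0, 1:]:]:] = g [:[:[:0, 1:]:]:]"
      "f [:[:0, 1:]:] = g [:[:0, 1:]:]" "f [:0, 1:] = g [:0, 1:]"
  shows "f p = g p"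
proof (rule poly_hom_eqI[OF f g _ assms(6)])
  have f1: "comm_ring_hom (\<lambda>c. f [:c:])" and g1: "comm_ring_hom (\<lambda>c. g [:c:])"
    by (rule comm_ring_hom_comp[OF f comm_ring_hom_const] comm_ring_hom_comp[OF g comm_ring_hom_const])+
  have f2: "comm_ring_hom (\<lambda>c. f [:[:c:]:])" and g2: "comm_ring_hom (\<lambda>c. g [:[:c:]:])"
    by (rule comm_ring_hom_comp[OF f1 comm_ring_hom_const] comm_ring_hom_comp[OF g1 comm_ring_hom_const])+
  show "f [:c:] = g [:c:]" for c
    by (rule poly_hom_eqI[OF f1 g1 poly_hom_eqI[OF f2 g2 assms(3,4)] assms(5)])
qed

lemma lift_coeff_minus_X: "lift_coeff [:0, - 1:] = - [:0, 1:]"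
proof -
  have "lift_coeff [:0, - 1:] = lift_coeff (- [:0, 1:])" by simp
  then show ?thesis by (simp only: lift_coeff_uminus lift_coeff_X)
qed

lemma subst3_back3: "subst3 (back3 q) = q" for q :: "'k::comm_ring_1 poly poly poly"
proof -
  interpret s: comm_ring_hom subst3 by (rule subst3_hom)
  interpret b: comm_ring_hom back3 by (rule back3_hom)
  \<comment> \<open>The only generator whose round trip is not immediate is \<open>v\<close>: it
    goes to \<open>z - u x\<close> and from there to \<open>(u x + v) - u x\<close>.\<close>
  have *: "back3 [:[:0, 1:]:] = [:[:0, 1:]:] + [:[:[:0, - 1:]:]:] * [:0, 1:]"
    by (simp add: coord_simps)
  show ?thesis
  proof (rule hom3_eqI[where f="\<lambda>q. subst3 (back3 q)" and g="\<lambda>q. q"])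
    show "subst3 (back3 [:[:0, 1:]:]) = [:[:0, 1:]:]"
      unfolding * s.hom_add s.hom_mult by (simp add: coord_simps lift_coeff_minus_X)
  qed (rule comm_ring_hom_comp[OF subst3_hom back3_hom] comm_ring_hom_id | (simp only: coord_simps; fail))+
qed

lemma back3_subst3: "back3 (subst3 p) = p" for p :: "'k::comm_ring_1 poly poly poly"
proof -
  interpret s: comm_ring_hom subst3 by (rule subst3_hom)
  interpret b: comm_ring_hom back3 by (rule back3_hom)
  have *: "subst3 [:[:0, 1:]:] = [:[:0, 1:]:] + [:[:[:0, 1:]:]:] * [:0, 1:]"
    by (simp add: coord_simps)
  show ?thesis
  proof (rule hom3_eqI[where f="\<lambda>q. back3 (subst3 q)" and g="\<lambda>q. q"])
    show "back3 (subst3 [:[:0, 1:]:]) = [:[:0, 1:]:]"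
      unfolding * b.hom_add b.hom_mult by (simp add: coord_simps lift_coeff_minus_X)
  qed (rule comm_ring_hom_comp[OF back3_hom subst3_hom] comm_ring_hom_id | (simp only: coord_simps; fail))+
qed

declare pCons_one [simp]

section \<open>Degree bounds\<close>

text \<open>
  The shift \<open>d\<close> makes \<open>g\<close> the coefficient of a polynomial of degree \<open>d\<close>; no subtraction is truncated, and
  the condition forces \<open>g = 0\<close> when \<open>n \<le> d\<close>. The same convention is used for \<open>homog\<close> below.
\<close>

definition deg_less :: "nat \<Rightarrow> nat \<Rightarrow> 'a::zero poly \<Rightarrow> bool" where
  "deg_less d n g \<longleftrightarrow> (\<forall>j. coeff g j \<noteq> 0 \<longrightarrow> j + d < n)"

definition tdeg_less :: "nat \<Rightarrow> nat \<Rightarrow> 'a::zero poly poly \<Rightarrow> bool" where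
  "tdeg_less d n F \<longleftrightarrow> (\<forall>k j. coeff (coeff F k) j \<noteq> 0 \<longrightarrow> j + k + d < n)"

lemma deg_less_iff: "deg_less d n g \<longleftrightarrow> g = 0 \<or> degree g + d < n"
proof
  assume b: "deg_less d n g"
  show "g = 0 \<or> degree g + d < n"
  proof (cases "g = 0")
    case False
    then have "coeff g (degree g) \<noteq> 0" by simp
    then show ?thesis using b by (auto simp: deg_less_def)
  qed simp
next
  assume "g = 0 \<or> degree g + d < n"
  then show "deg_less d n g"
    unfolding deg_less_def using le_degree by fastforce
qed

lemma deg_less_0 [simp]: "deg_less d n 0" by (simp add: deg_less_def)

lemma deg_less_add: "deg_less d n p \<Longrightarrow> deg_less d n q \<Longrightarrow> deg_less d n (p + q)" for p :: "'a::comm_monoid_add poly"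
  unfolding deg_less_def by (metis add.right_neutral coeff_add)

lemma deg_less_smult: "deg_less d n p \<Longrightarrow> deg_less d n (smult c p)" for p :: "'a::comm_semiring_0 poly"
  unfolding deg_less_def by (metis coeff_smult mult_zero_right)

lemma deg_less_pCons: "deg_less d n (pCons c q) \<longleftrightarrow> (c \<noteq> 0 \<longrightarrow> d < n) \<and> deg_less (Suc d) n q"
proof -
  have *: "(\<forall>k. P k) \<longleftrightarrow> P 0 \<and> (\<forall>k. P (Suc k))" for P :: "nat \<Rightarrow> bool"
    by (metis not0_implies_Suc)
  show ?thesis unfolding deg_less_def by (subst *) simp
qed

lemma tdeg_less_pCons: "tdeg_less d n (pCons c q) \<longleftrightarrow> deg_less d n c \<and> tdeg_less (Suc d) n q"
proof -
  have *: "(\<forall>k. P k) \<longleftrightarrow> P 0 \<and> (\<forall>k. P (Suc k))" for P :: "nat \<Rightarrow> bool"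
    by (metis not0_implies_Suc)
  show ?thesis unfolding tdeg_less_def deg_less_def by (subst *) simp
qed

lemma deg_less_linear_mult:
  fixes q :: "'a::comm_ring_1 poly"
  assumes "deg_less (Suc d) n q"
  shows "deg_less d n ([:a, b:] * q)"
proof -
  have "deg_less d n (smult a q)" using assms by (intro deg_less_smult) (auto simp: deg_less_def)
  moreover have "deg_less d n (pCons 0 (smult b q))" using assms by (simp add: deg_less_pCons deg_less_smult)
  ultimately show ?thesis by (simp add: deg_less_add)
qed

text \<open>Horner recursion in the outer variable: each factor \<open>[:a, b:]\<close> raises the
  degree by at most one, which the shift \<open>d\<close> accounts for. The parameter
  \<open>h\<close> covers both the generic line and, as the identity, a line over
  \<open>K\<close>.\<close>

lemma deg_less_line:
  fixes h :: "'k::comm_ring_1 \<Rightarrow> 'a::comm_ring_1"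
  assumes "comm_ring_hom h" "tdeg_less d n F"
  shows "deg_less d n (poly (map_poly (map_poly h) F) [:a, b:])"
  using assms(2)
proof (induction F arbitrary: d)
  case 0
  then show ?case by simp
next
  case (pCons r F)
  interpret comm_ring_hom h by fact
  have "deg_less d n (map_poly h r)" using pCons.prems
    unfolding tdeg_less_pCons deg_less_def coeff_map_poly_hom by (metis hom_zero)
  moreover have "deg_less d n ([:a, b:] * poly (map_poly (map_poly h) F) [:a, b:])"
    using pCons.IH[of "Suc d"] pCons.prems by (intro deg_less_linear_mult) (simp add: tdeg_less_pCons)
  ultimately show ?case
    by (simp add: Polynomial.map_poly_pCons deg_less_add del: mult_pCons_left)
qed

text \<open>The monomial \<open>x^j z^k\<close> of \<open>F\<close> is the only one that contributes to \<open>u^k v^0 x^(j + k)\<close>.\<close>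
lemma coeff_subst2:
  "coeff (coeff (coeff (subst2 F) n) 0) k = (if k \<le> n then coeff (coeff F k) (n - k) else 0)"
proof (induction F arbitrary: n k)
  case 0
  then show ?case by (simp add: subst2_def)
next
  case (pCons r F)
  interpret s: comm_ring_hom subst2 by (rule subst2_hom)
  have e: "pCons r F = [:r:] + [:0, 1:] * F" by simp
  have "subst2 (pCons r F) = lift_coeff r + [:[:0, 1:], [:[:0, 1:]:]:] * subst2 F"
    unfolding e s.hom_add s.hom_mult subst2_const subst2_X ..
  moreover have "coeff (lift_coeff r) n = [:[:coeff r n:]:]" for n
    by (simp add: lift_coeff_def coeff_map_poly)
  ultimately show ?case
    by (cases n; cases k) (auto simp: pCons.IH coeff_pCons)
qed

text \<open>Restriction to the generic line preserves the total degree: a linear substitution cannot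
  raise it, and by \<open>coeff_subst2\<close> every coefficient of \<open>F\<close> survives in the
  result.\<close>

lemma deg_less_subst2_iff: "deg_less d n (subst2 F) \<longleftrightarrow> tdeg_less d n F"
proof
  assume b: "deg_less d n (subst2 F)"
  show "tdeg_less d n F"
    unfolding tdeg_less_def
  proof (intro allI impI)
    fix k j assume "coeff (coeff F k) j \<noteq> 0"
    then have "coeff (coeff (coeff (subst2 F) (j + k)) 0) k \<noteq> 0" by (simp add: coeff_subst2)
    then have "coeff (subst2 F) (j + k) \<noteq> 0" by auto
    then show "j + k + d < n" using b unfolding deg_less_def by blast
  qed
next
  assume "tdeg_less d n F"
  from deg_less_line[OF comm_ring_hom_comp[OF comm_ring_hom_const comm_ring_hom_const] this]
  show "deg_less d n (subst2 F)" by (simp add: subst2_def lift_coeff_def[abs_def])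
qed

section \<open>The derivation in the coordinates \<open>u\<close>, \<open>v\<close>,
  \<open>x\<close>\<close>

lemma pderiv_lift_coeff: "pderiv (lift_coeff r) = lift_coeff (pderiv r)" for r :: "'k::idom poly"
  by (rule poly_eqI) (simp add: lift_coeff_def coeff_pderiv coeff_map_poly of_nat_poly)

lemma pderiv_back2_X: "pderiv (back2 [:0, 1:]) = - [:[:[:0, 1 :: 'k::idom:]:]:]"
  unfolding back2_X by (simp add: pderiv_pCons del: pCons_one)

text \<open>In the coordinates \<open>u\<close>, \<open>v\<close>, \<open>x\<close> the derivation
  is \<partial>_u - x \<partial>_v, so it sends a polynomial in \<open>u\<close> and
  \<open>v\<close> alone to one that is linear in \<open>x\<close>. The witnesses built here are the
  \<open>u\<close>-derivative and minus the \<open>v\<close>-derivative of \<open>c\<close>.\<close>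

lemma pderiv_back2:
  fixes c :: "'k::idom poly poly"
  shows "\<exists>c1 c2. pderiv (back2 c) = back3 [:c1, c2:]"
proof (induction c)
  case 0
  have "pderiv (back2 0) = back3 [:0, 0:]" by (simp add: back2_def back3_def)
  then show ?case by blast
next
  case (pCons r c)
  then obtain c1 c2 where c: "pderiv (back2 c) = back3 [:c1, c2:]" by blast
  interpret b: comm_ring_hom "back2 :: 'k poly poly \<Rightarrow> _" by (rule back2_hom)
  interpret b3: comm_ring_hom "back3 :: 'k poly poly poly \<Rightarrow> _" by (rule back3_hom)
  have e: "pCons r c = [:r:] + [:0, 1:] * c" by simp
  have "pderiv (back2 (pCons r c)) = lift_coeff (pderiv r)
      + (back2 [:0, 1:] * back3 [:c1, c2:] + back2 c * (- back3 [:0, 1:]))"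
    unfolding e b.hom_add b.hom_mult pderiv_add pderiv_mult back2_const pderiv_lift_coeff c
      pderiv_back2_X back3_X ..
  also have "\<dots> = back3 [:[:pderiv r:]:] + (back3 [:[:0, 1:]:] * back3 [:c1, c2:] + back3 [:c:] * (- back3 [:0, 1:]))"
    by (simp only: back3_const back2_const)
  also have "\<dots> = back3 ([:[:pderiv r:]:] + ([:[:0, 1:]:] * [:c1, c2:] + [:c:] * (- [:0, 1:])))"
    by (simp only: b3.hom_add b3.hom_mult b3.hom_uminus)
  also have "[:[:pderiv r:]:] + ([:[:0, 1:]:] * [:c1, c2:] + [:c:] * (- [:0, 1:])) =
     [:[:pderiv r:] + [:0, 1:] * c1, [:0, 1:] * c2 - c:]"
    by (simp del: pCons_one)
  finally show ?case by blast
qed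

text \<open>The derivation kills \<open>x\<close> and turns each coefficient into a linear
  polynomial in \<open>x\<close>, so the degree in \<open>x\<close> grows by at most one. One
  \<open>q'\<close> has to serve all \<open>d\<close> and \<open>n\<close>, since the induction
  shifts \<open>d\<close>.\<close>

lemma pderiv_back3:
  fixes q :: "'k::idom poly poly poly"
  shows "\<exists>q'. pderiv (back3 q) = back3 q' \<and> (\<forall>d n. deg_less d n q \<longrightarrow> deg_less d (Suc n) q')"
proof (induction q)
  case 0
  have "back3 0 = 0" by (simp add: back3_def)
  then show ?case by (metis pderiv_0 deg_less_0)
next
  case (pCons c q)
  then obtain q' where q': "pderiv (back3 q) = back3 q'" "\<And>d n. deg_less d n q \<Longrightarrow> deg_less d (Suc n) q'" by blast
  \<comment> \<open>For \<open>c = 0\<close> the degree hypothesis gives no information on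
    \<open>d < n\<close>, so \<open>c1\<close> and \<open>c2\<close> must then be chosen as
    zero.\<close>
  obtain c1 c2 where c: "pderiv (back2 c) = back3 [:c1, c2:]" "c = 0 \<Longrightarrow> c1 = 0 \<and> c2 = 0"
  proof (cases "c = 0")
    case True
    then have "pderiv (back2 c) = back3 [:0, 0:]" by (simp add: back2_def back3_def)
    then show thesis using that by blast
  next
    case False
    then show thesis using that pderiv_back2[of c] by blast
  qed
  interpret b3: comm_ring_hom back3 by (rule back3_hom)
  have e: "pCons c q = [:c:] + [:0, 1:] * q" by simp
  have "pderiv (back3 [:0, 1 :: 'k poly poly:]) = 0" unfolding back3_X by (simp add: pderiv_pCons)
  then have "pderiv (back3 (pCons c q)) = back3 ([:c1, c2:] + [:0, 1:] * q')"
    unfolding e b3.hom_add b3.hom_mult pderiv_add pderiv_mult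
    by (simp only: back3_const c q'(1) mult_zero_right add_0_right)
  moreover have "deg_less d (Suc n) ([:c1, c2:] + [:0, 1:] * q')" if "deg_less d n (pCons c q)" for d n
  proof (rule deg_less_add)
    show "deg_less d (Suc n) [:c1, c2:]" using that c(2) by (auto simp: deg_less_pCons)
    have "deg_less (Suc d) (Suc n) q'" using that by (intro q'(2)) (simp add: deg_less_pCons)
    then show "deg_less d (Suc n) ([:0, 1:] * q')" by (rule deg_less_linear_mult)
  qed
  ultimately show ?case by blast
qed

lemma deg_less_subst3_pderiv:
  fixes p :: "'k::idom poly poly poly"
  assumes "deg_less d n (subst3 p)"
  shows "deg_less d (Suc n) (subst3 (pderiv p))"
proof -
  obtain q' where "pderiv (back3 (subst3 p)) = back3 q'" "deg_less d (Suc n) q'"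
    using pderiv_back3[of "subst3 p"] assms by blast
  then show ?thesis by (simp add: back3_subst3 subst3_back3)
qed

section \<open>The determinant of three binary forms\<close>

definition coeff_mat :: "nat \<Rightarrow> (nat \<Rightarrow> 'a::zero poly) \<Rightarrow> 'a mat" where
  "coeff_mat n \<phi> = mat n n (\<lambda>(r, c). coeff (\<phi> c) r)"

lemma coeff_mat_carrier [simp]: "coeff_mat n \<phi> \<in> carrier_mat n n"
  by (simp add: coeff_mat_def)

lemma coeff_mat_mult_vec:
  fixes \<phi> :: "nat \<Rightarrow> 'a::comm_ring_1 poly"
  assumes "v \<in> carrier_vec n" "r < n"
  shows "(coeff_mat n \<phi> *\<^sub>v v) $ r = coeff (\<Sum>c<n. smult (v $ c) (\<phi> c)) r"
  using assms
  by (simp add: coeff_mat_def scalar_prod_def coeff_sum atLeast0LessThan mult.commute)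

lemma deg_less_sum:
  fixes f :: "'b \<Rightarrow> 'a::comm_monoid_add poly"
  assumes "\<And>c. c \<in> A \<Longrightarrow> deg_less d n (f c)"
  shows "deg_less d n (sum f A)"
  using assms by (induction A rule: infinite_finite_induct) (auto intro: deg_less_add)

lemma deg_less_eqI: "deg_less 0 n p \<Longrightarrow> deg_less 0 n q \<Longrightarrow> (\<And>r. r < n \<Longrightarrow> coeff p r = coeff q r) \<Longrightarrow> p = q"
  unfolding deg_less_def by (metis add.right_neutral poly_eqI)

lemma coeff_mat_mult_vec_eq_iff:
  fixes \<phi> :: "nat \<Rightarrow> 'a::comm_ring_1 poly"
  assumes "v \<in> carrier_vec n" "\<And>c. c < n \<Longrightarrow> deg_less 0 n (\<phi> c)" "deg_less 0 n h"
  shows "coeff_mat n \<phi> *\<^sub>v v = vec n (coeff h) \<longleftrightarrow> (\<Sum>c<n. smult (v $ c) (\<phi> c)) = h"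
proof -
  have "deg_less 0 n (\<Sum>c<n. smult (v $ c) (\<phi> c))" using assms by (intro deg_less_sum deg_less_smult) auto
  moreover have "coeff_mat n \<phi> *\<^sub>v v = vec n (coeff h) \<longleftrightarrow>
      (\<forall>r<n. coeff (\<Sum>c<n. smult (v $ c) (\<phi> c)) r = coeff h r)"
  proof -
    have "dim_vec (coeff_mat n \<phi> *\<^sub>v v) = n" by (simp add: coeff_mat_def)
    then show ?thesis
      by (auto simp: vec_eq_iff coeff_mat_mult_vec[OF assms(1)] simp del: index_mult_mat_vec)
  qed
  ultimately show ?thesis using deg_less_eqI[OF _ assms(3)] by blast
qed

lemma vec_coeff_0: "vec n (coeff (0 :: 'a::zero poly)) = 0\<^sub>v n"
  by (rule eq_vecI) simp_all

lemma det_coeff_mat_zero_imp: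
  fixes \<phi> :: "nat \<Rightarrow> 'a::idom poly"
  assumes "\<And>c. c < n \<Longrightarrow> deg_less 0 n (\<phi> c)" "det (coeff_mat n \<phi>) = 0"
  obtains v where "\<exists>c<n. v c \<noteq> 0" "(\<Sum>c<n. smult (v c) (\<phi> c)) = 0"
proof -
  obtain v where v: "v \<in> carrier_vec n" "v \<noteq> 0\<^sub>v n" "coeff_mat n \<phi> *\<^sub>v v = 0\<^sub>v n"
    using assms det_0_iff_vec_prod_zero[OF coeff_mat_carrier] by metis
  then have "(\<Sum>c<n. smult (v $ c) (\<phi> c)) = 0"
    using coeff_mat_mult_vec_eq_iff[of v n \<phi> 0] assms(1) by (simp add: vec_coeff_0)
  moreover have "\<exists>c<n. v $ c \<noteq> 0" using v by (auto simp: vec_eq_iff)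
  ultimately show thesis using that by blast
qed

lemma det_coeff_mat_nonzero_inj:
  fixes \<phi> :: "nat \<Rightarrow> 'a::idom poly"
  assumes "\<And>c. c < n \<Longrightarrow> deg_less 0 n (\<phi> c)" "det (coeff_mat n \<phi>) \<noteq> 0"
    and "(\<Sum>c<n. smult (v c) (\<phi> c)) = 0" "c < n"
  shows "v c = 0"
proof -
  have "coeff_mat n \<phi> *\<^sub>v vec n v = 0\<^sub>v n"
    using coeff_mat_mult_vec_eq_iff[of "vec n v" n \<phi> 0] assms by (simp add: vec_coeff_0)
  then have "vec n v = 0\<^sub>v n"
    using assms det_0_iff_vec_prod_zero[OF coeff_mat_carrier, of n \<phi>] vec_carrier by blast
  then show ?thesis using \<open>c < n\<close> by (metis index_vec index_zero_vec(1))
qed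

lemma det_coeff_mat_nonzero_surj:
  fixes \<phi> :: "nat \<Rightarrow> 'a::field poly"
  assumes "\<And>c. c < n \<Longrightarrow> deg_less 0 n (\<phi> c)" "det (coeff_mat n \<phi>) \<noteq> 0" "deg_less 0 n h"
  obtains v where "(\<Sum>c<n. smult (v c) (\<phi> c)) = h"
proof -
  let ?A = "coeff_mat n \<phi>" and ?h = "vec n (coeff h)"
  \<comment> \<open>Cramer's rule: the adjugate applied to the right-hand side, divided by the
    determinant.\<close>
  define v where "v = inverse (det ?A) \<cdot>\<^sub>v (adj_mat ?A *\<^sub>v ?h)"
  note adj = adj_mat[OF coeff_mat_carrier[of n \<phi>]]
  have w: "adj_mat ?A *\<^sub>v ?h \<in> carrier_vec n" using adj(1) by simp
  then have v: "v \<in> carrier_vec n" by (simp add: v_def)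
  have "?A *\<^sub>v v = inverse (det ?A) \<cdot>\<^sub>v (?A *\<^sub>v (adj_mat ?A *\<^sub>v ?h))"
    unfolding v_def by (rule mult_mat_vec[OF coeff_mat_carrier w])
  also have "?A *\<^sub>v (adj_mat ?A *\<^sub>v ?h) = (?A * adj_mat ?A) *\<^sub>v ?h"
    by (rule assoc_mult_mat_vec[symmetric, OF coeff_mat_carrier adj(1)]) simp
  also have "\<dots> = det ?A \<cdot>\<^sub>v ?h"
    unfolding adj(2)
    by (rule eq_vecI) (simp_all add: scalar_prod_def mult.assoc row_def if_distrib[of "\<lambda>x. x * _"] flip: sum_distrib_left cong: if_cong)
  also have "inverse (det ?A) \<cdot>\<^sub>v (det ?A \<cdot>\<^sub>v ?h) = ?h"
    using assms(2) by (simp add: smult_smult_assoc)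
  finally show thesis
    using coeff_mat_mult_vec_eq_iff[of v n \<phi> h] v assms(1,3) that by blast
qed

section \<open>The Sylvester-type matrix of three polynomials\<close>

definition syz_col :: "nat \<Rightarrow> nat \<Rightarrow> 'a::comm_ring_1 poly \<Rightarrow> 'a poly \<Rightarrow> 'a poly \<Rightarrow> nat \<Rightarrow> 'a poly" where
  "syz_col m1 m2 f1 f2 f3 c =
     (if c < m1 then monom 1 c * f1
      else if c < m1 + m2 then monom 1 (c - m1) * f2
      else monom 1 (c - (m1 + m2)) * f3)"

lemma sum_lessThan_add: "(\<Sum>c<a + b. f c) = (\<Sum>c<a. f c) + (\<Sum>c<b. f (a + c))"
  for f :: "nat \<Rightarrow> 'a::comm_monoid_add"
  by (induction b) (simp_all add: add.assoc)

lemma sum_syz_col: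
  "(\<Sum>c<m1 + m2 + m3. smult (v c) (syz_col m1 m2 f1 f2 f3 c)) =
     (\<Sum>c<m1. monom (v c) c) * f1 + (\<Sum>c<m2. monom (v (m1 + c)) c) * f2
     + (\<Sum>c<m3. monom (v (m1 + m2 + c)) c) * f3"
proof -
  have *: "smult a (monom 1 c * f) = monom a c * f" for a :: 'a and c f
    by (metis mult.right_neutral mult_smult_left smult_monom)
  show ?thesis
    by (simp add: sum_lessThan_add syz_col_def * sum_distrib_right)
qed

lemma coeff_sum_monom_lessThan: "coeff (\<Sum>c<m. monom (v c) c) i = (if i < m then v i else 0)"
  by (simp add: coeff_sum)

lemma deg_less_sum_monom: "deg_less d n (\<Sum>c<n - d. monom (v c) c)"
  by (auto simp: deg_less_def coeff_sum_monom_lessThan split: if_splits)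

lemma deg_less_eq_sum_monom: "deg_less d n g \<Longrightarrow> g = (\<Sum>c<n - d. monom (coeff g c) c)"
  by (rule poly_eqI) (auto simp: deg_less_def coeff_sum_monom_lessThan less_diff_conv)

text \<open>Determinant of the map \<open>(g1, g2, g3) \<mapsto> g1 * f1 + g2 * f2 + g3 * f3\<close>
  in monomial bases, with \<open>n - d1\<close>, \<open>n - d2\<close>, \<open>n - d3\<close>
  coefficients for the \<open>g\<close>'s and \<open>n\<close> for the value. If
  \<open>d1 + d2 + d3 = 2 * n\<close> and no degree exceeds \<open>n\<close>, the map is square and
  the third block has \<open>n - d3\<close> columns, so \<open>d3\<close> stays implicit.\<close>

definition syz_det :: "nat \<Rightarrow> nat \<Rightarrow> nat \<Rightarrow> 'a::comm_ring_1 poly \<Rightarrow> 'a poly \<Rightarrow> 'a poly \<Rightarrow> 'a" where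
  "syz_det n d1 d2 f1 f2 f3 = det (coeff_mat n (syz_col (n - d1) (n - d2) f1 f2 f3))"

text \<open>The determinant is a polynomial in the coefficients of \<open>f1\<close>,
  \<open>f2\<close>, \<open>f3\<close>; hence the one for the generic line specialises to those for
  individual lines.\<close>

lemma syz_det_hom:
  assumes "comm_ring_hom h"
  shows "syz_det n d1 d2 (map_poly h f1) (map_poly h f2) (map_poly h f3) = h (syz_det n d1 d2 f1 f2 f3)"
proof -
  interpret comm_ring_hom h by fact
  interpret m: map_poly_comm_ring_hom h ..
  have "map_poly h (monom 1 c * f) = monom 1 c * map_poly h f" for c f
    by (simp add: m.hom_mult)
  then have "syz_col m1 m2 (map_poly h f1) (map_poly h f2) (map_poly h f3) c
      = map_poly h (syz_col m1 m2 f1 f2 f3 c)" for m1 m2 c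
    by (simp add: syz_col_def)
  then have "coeff_mat n (syz_col (n - d1) (n - d2) (map_poly h f1) (map_poly h f2) (map_poly h f3))
      = map_mat h (coeff_mat n (syz_col (n - d1) (n - d2) f1 f2 f3))"
    by (intro eq_matI) (simp_all only: coeff_mat_def dim_row_mat dim_col_mat index_map_mat index_mat
      prod.case coeff_map_poly_hom)
  then show ?thesis by (simp add: syz_det_def)
qed

definition append_seq :: "nat \<Rightarrow> nat \<Rightarrow> (nat \<Rightarrow> 'a) \<Rightarrow> (nat \<Rightarrow> 'a) \<Rightarrow> (nat \<Rightarrow> 'a) \<Rightarrow> nat \<Rightarrow> 'a" where
  "append_seq m1 m2 a b e c = (if c < m1 then a c else if c < m1 + m2 then b (c - m1) else e (c - (m1 + m2)))"

lemma sum_append_seq: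
  "(\<Sum>c<m1. monom (append_seq m1 m2 a b e c) c) = (\<Sum>c<m1. monom (a c) c)"
  "(\<Sum>c<m2. monom (append_seq m1 m2 a b e (m1 + c)) c) = (\<Sum>c<m2. monom (b c) c)"
  "(\<Sum>c<m3. monom (append_seq m1 m2 a b e (m1 + m2 + c)) c) = (\<Sum>c<m3. monom (e c) c)"
  by (simp_all add: append_seq_def)

context
  fixes n d1 d2 d3 :: nat and f1 f2 f3 :: "'a::idom poly"
  assumes deg: "d1 \<le> n" "d2 \<le> n" "d3 \<le> n" "d1 + d2 + d3 = 2 * n"
    and f: "deg_less 0 (Suc d1) f1" "deg_less 0 (Suc d2) f2" "deg_less 0 (Suc d3) f3"
begin

lemma syz_dims: "n = (n - d1) + (n - d2) + (n - d3)"
  using deg by linarith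

lemma deg_less_syz_col:
  assumes "c < n"
  shows "deg_less 0 n (syz_col (n - d1) (n - d2) f1 f2 f3 c)"
proof -
  have *: "deg_less 0 n (monom 1 c * f)" if "c < n - d" "deg_less 0 (Suc d) f" for c d and f :: "'a poly"
    using that degree_mult_le[of "monom 1 c" f] degree_monom_le[of "1::'a" c]
    unfolding deg_less_iff by (cases "f = 0") auto
  have "c - (n - d1 + (n - d2)) < n - d3" if "\<not> c < n - d1 + (n - d2)"
    using that assms syz_dims by linarith
  moreover have "c - (n - d1) < n - d2" if "c < n - d1 + (n - d2)" "\<not> c < n - d1"
    using that by linarith
  ultimately show ?thesis unfolding syz_col_def using *[OF _ f(1)] *[OF _ f(2)] *[OF _ f(3)] by simp
qed

lemma sum_syz:
  "(\<Sum>c<n. smult (v c) (syz_col (n - d1) (n - d2) f1 f2 f3 c)) =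
     (\<Sum>c<n - d1. monom (v c) c) * f1 + (\<Sum>c<n - d2. monom (v (n - d1 + c)) c) * f2
     + (\<Sum>c<n - d3. monom (v (n - d1 + (n - d2) + c)) c) * f3"
  using sum_syz_col[of v "n - d1" "n - d2" f1 f2 f3 "n - d3"] unfolding syz_dims[symmetric] .

text \<open>A kernel vector of the singular matrix is cut into the coefficient sequences of
  \<open>g1\<close>, \<open>g2\<close> and \<open>g3\<close>.\<close>

lemma syz_det_zero_imp:
  assumes "syz_det n d1 d2 f1 f2 f3 = 0"
  obtains g1 g2 g3 where "g1 \<noteq> 0 \<or> g2 \<noteq> 0 \<or> g3 \<noteq> 0"
    "deg_less d1 n g1" "deg_less d2 n g2" "deg_less d3 n g3" "g1 * f1 + g2 * f2 + g3 * f3 = 0"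
proof -
  obtain v where v: "\<exists>c<n. v c \<noteq> 0" "(\<Sum>c<n. smult (v c) (syz_col (n - d1) (n - d2) f1 f2 f3 c)) = 0"
    by (rule det_coeff_mat_zero_imp[OF deg_less_syz_col assms[unfolded syz_det_def]])
  let ?g1 = "\<Sum>c<n - d1. monom (v c) c" and ?g2 = "\<Sum>c<n - d2. monom (v (n - d1 + c)) c"
    and ?g3 = "\<Sum>c<n - d3. monom (v (n - d1 + (n - d2) + c)) c"
  from v(1) obtain c where c: "c < n" "v c \<noteq> 0" by blast
  have "?g1 \<noteq> 0 \<or> ?g2 \<noteq> 0 \<or> ?g3 \<noteq> 0"
  proof -
    consider "c < n - d1" | i where "c = n - d1 + i" "i < n - d2"
      | i where "c = n - d1 + (n - d2) + i" "i < n - d3"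
    proof -
      have "c < n - d1 \<or> c = n - d1 + (c - (n - d1)) \<and> c - (n - d1) < n - d2
        \<or> c = n - d1 + (n - d2) + (c - (n - d1 + (n - d2))) \<and> c - (n - d1 + (n - d2)) < n - d3"
        using c(1) syz_dims by linarith
      then show thesis using that by blast
    qed
    then show ?thesis
    proof cases
      case 1
      then have "coeff ?g1 c \<noteq> 0" using c by (simp add: coeff_sum_monom_lessThan)
      then show ?thesis by (metis coeff_0)
    next
      case (2 i)
      then have "coeff ?g2 i \<noteq> 0" using c by (simp add: coeff_sum_monom_lessThan)
      then show ?thesis by (metis coeff_0)
    next
      case (3 i)
      then have "coeff ?g3 i \<noteq> 0" using c by (simp add: coeff_sum_monom_lessThan)
      then show ?thesis by (metis coeff_0)
    qed
  qed
  then show thesis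
    by (rule that[OF _ deg_less_sum_monom deg_less_sum_monom deg_less_sum_monom v(2)[unfolded sum_syz]])
qed

lemma syz_det_nonzero_inj:
  assumes "syz_det n d1 d2 f1 f2 f3 \<noteq> 0"
    and g: "deg_less d1 n g1" "deg_less d2 n g2" "deg_less d3 n g3" "g1 * f1 + g2 * f2 + g3 * f3 = 0"
  shows "g1 = 0 \<and> g2 = 0 \<and> g3 = 0"
proof -
  define v where "v = append_seq (n - d1) (n - d2) (coeff g1) (coeff g2) (coeff g3)"
  have e: "g1 = (\<Sum>c<n - d1. monom (v c) c)" "g2 = (\<Sum>c<n - d2. monom (v (n - d1 + c)) c)"
    "g3 = (\<Sum>c<n - d3. monom (v (n - d1 + (n - d2) + c)) c)"
    unfolding v_def sum_append_seq by (rule deg_less_eq_sum_monom g)+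
  have "(\<Sum>c<n. smult (v c) (syz_col (n - d1) (n - d2) f1 f2 f3 c)) = 0"
    unfolding sum_syz e[symmetric] by (rule g(4))
  from det_coeff_mat_nonzero_inj[OF deg_less_syz_col assms(1)[unfolded syz_det_def] this]
  have v0: "v c = 0" if "c < n" for c using that by blast
  have "v c = 0" if "c < n - d1" for c using that by (intro v0) linarith
  moreover have "v (n - d1 + c) = 0" if "c < n - d2" for c
    using that syz_dims by (intro v0) linarith
  moreover have "v (n - d1 + (n - d2) + c) = 0" if "c < n - d3" for c
    using that syz_dims by (intro v0) linarith
  ultimately show ?thesis unfolding e by simp
qed

end

text \<open>Solving the linear system divides by the determinant, hence a field in place of the
  integral domain of the preceding context.\<close>

lemma syz_det_nonzero_surj:
  fixes f1 f2 f3 :: "'a::field poly"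
  assumes deg: "d1 \<le> n" "d2 \<le> n" "d3 \<le> n" "d1 + d2 + d3 = 2 * n"
    and f: "deg_less 0 (Suc d1) f1" "deg_less 0 (Suc d2) f2" "deg_less 0 (Suc d3) f3"
    and "syz_det n d1 d2 f1 f2 f3 \<noteq> 0" "deg_less 0 n h"
  obtains g1 g2 g3 where "deg_less d1 n g1" "deg_less d2 n g2" "deg_less d3 n g3" "g1 * f1 + g2 * f2 + g3 * f3 = h"
proof -
  obtain v where v: "(\<Sum>c<n. smult (v c) (syz_col (n - d1) (n - d2) f1 f2 f3 c)) = h"
    by (rule det_coeff_mat_nonzero_surj[OF deg_less_syz_col[OF deg f] assms(8)[unfolded syz_det_def] assms(9)])
  show thesis
    by (rule that[OF deg_less_sum_monom deg_less_sum_monom deg_less_sum_monom v[unfolded sum_syz[OF deg f]]])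
qed

section \<open>Descent of a syzygy from the generic line\<close>

lemma deg_less_mult:
  fixes p q :: "'a::idom poly"
  assumes "deg_less a n p" "deg_less b (Suc m) q"
  shows "deg_less (a + b) (n + m) (p * q)"
  using assms degree_mult_le[of p q] unfolding deg_less_iff by fastforce

lemma deg_less_factor:
  fixes p q :: "'a::idom poly"
  assumes "deg_less d n (p * q)" "q \<noteq> 0"
  shows "deg_less d n p"
  using assms degree_mult_eq[of p q] by (cases "p = 0") (auto simp: deg_less_iff)

lemma deg_less_diff: "deg_less d n p \<Longrightarrow> deg_less d n q \<Longrightarrow> deg_less d n (p - q)" for p :: "'a::ab_group_add poly"
  unfolding deg_less_def by (metis coeff_diff diff_self)

lemma deg_less_cancel: "deg_less (d + e) (n + e) p \<longleftrightarrow> deg_less d n p"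
  by (simp add: deg_less_def flip: add.assoc)

text \<open>In characteristic zero the derivative of a nonconstant polynomial is nonzero and of
  smaller degree.\<close>

lemma dvd_pderiv_imp_const:
  fixes q :: "'a::{idom, semiring_char_0} poly"
  assumes "q dvd pderiv q"
  obtains c where "q = [:c:]"
proof -
  have "degree q = 0"
  proof (rule ccontr)
    assume "degree q \<noteq> 0"
    moreover from this have "pderiv q \<noteq> 0" by (simp add: pderiv_eq_0_iff)
    ultimately show False
      using dvd_imp_degree_le[OF assms] degree_pderiv_le[of q] by (simp add: degree_pderiv)
  qed
  then show thesis using that degree0_coeffs by blast
qed

text \<open>Two vectors orthogonal to \<open>a\<close> have a cross product parallel to
  \<open>a\<close>. Each difference of the two sides is an explicit combination of the two
  relations.\<close>

lemma cross_product_parallel: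
  fixes a1 a2 a3 p1 p2 p3 q1 q2 q3 :: "'a::comm_ring_1"
  assumes p: "p1 * a1 + p2 * a2 + p3 * a3 = 0" and q: "q1 * a1 + q2 * a2 + q3 * a3 = 0"
  shows "a1 * (p3 * q1 - p1 * q3) = a2 * (p2 * q3 - p3 * q2)"
    and "a1 * (p1 * q2 - p2 * q1) = a3 * (p2 * q3 - p3 * q2)"
proof -
  have "a1 * (p3 * q1 - p1 * q3) - a2 * (p2 * q3 - p3 * q2) =
      p3 * (q1 * a1 + q2 * a2 + q3 * a3) - q3 * (p1 * a1 + p2 * a2 + p3 * a3)"
    "a1 * (p1 * q2 - p2 * q1) - a3 * (p2 * q3 - p3 * q2) =
      q2 * (p1 * a1 + p2 * a2 + p3 * a3) - p2 * (q1 * a1 + q2 * a2 + q3 * a3)"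
    by (simp_all add: algebra_simps)
  then show "a1 * (p3 * q1 - p1 * q3) = a2 * (p2 * q3 - p3 * q2)"
    "a1 * (p1 * q2 - p2 * q1) = a3 * (p2 * q3 - p3 * q2)"
    by (simp_all add: p q)
qed

text \<open>The \<open>p\<close>'s are polynomials in \<open>u\<close> over \<open>K[x][z]\<close>,
  so the \<open>F\<close>'s are constants for \<open>pderiv\<close> and differentiating the syzygy
  gives a second one. For dehomogenised forms, \<open>inf\<close> says that \<open>F1\<close> and
  \<open>F2\<close> do not both drop below their nominal degrees, that is, the line
  \<open>y = 0\<close> is not a common component.\<close>

lemma syzygy_descends:
  fixes F1 F2 F3 :: "'k::field_char_0 poly poly" and p1 p2 p3 :: "'k poly poly poly"
  assumes deg: "d1 + d2 + d3 = 2 * n"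
    and F1: "F1 \<noteq> 0"
    and cop: "\<And>h. F1 dvd F2 * h \<Longrightarrow> F1 dvd h"
    and inf: "\<not> (tdeg_less 0 d1 F1 \<and> tdeg_less 0 d2 F2)"
    and nz: "p1 \<noteq> 0 \<or> p2 \<noteq> 0 \<or> p3 \<noteq> 0"
    and b: "deg_less d1 n (subst3 p1)" "deg_less d2 n (subst3 p2)" "deg_less d3 n (subst3 p3)"
    and syz: "p1 * [:F1:] + p2 * [:F2:] + p3 * [:F3:] = 0"
  obtains G1 G2 G3 where "G1 \<noteq> 0 \<or> G2 \<noteq> 0 \<or> G3 \<noteq> 0"
    "tdeg_less d1 n G1" "tdeg_less d2 n G2" "tdeg_less d3 n G3" "G1 * F1 + G2 * F2 + G3 * F3 = 0"
proof -
  interpret s: comm_ring_hom "subst3 :: 'k poly poly poly \<Rightarrow> _" by (rule subst3_hom)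
  have s0: "subst3 p \<noteq> 0" if "p \<noteq> 0" for p :: "'k poly poly poly"
  proof
    assume "subst3 p = 0"
    then have "back3 (subst3 p) = 0" by (simp add: back3_def)
    then show False using that by (simp add: back3_subst3)
  qed
  have "pderiv (p1 * [:F1:] + p2 * [:F2:] + p3 * [:F3:]) = 0" by (simp only: syz pderiv_0)
  then have syz': "pderiv p1 * [:F1:] + pderiv p2 * [:F2:] + pderiv p3 * [:F3:] = 0"
    by (simp only: pderiv_add pderiv_mult pderiv_pCons pderiv_0 pCons_0_0 add_0_right mult_zero_right mult.commute add_0_left mult_zero_left)
  define w1 w2 w3 where
    "w1 = p2 * pderiv p3 - p3 * pderiv p2" and
    "w2 = p3 * pderiv p1 - p1 * pderiv p3" and
    "w3 = p1 * pderiv p2 - p2 * pderiv p1"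
  have E2: "[:F1:] * w2 = [:F2:] * w1" and E3: "[:F1:] * w3 = [:F3:] * w1"
    unfolding w1_def w2_def w3_def by (rule cross_product_parallel[OF syz syz'])+
  \<comment> \<open>Divisibility by \<open>[:F1:]\<close> is tested on each coefficient in
    \<open>u\<close>, where \<open>cop\<close> applies.\<close>
  have "F1 dvd F2 * coeff w1 k" for k
  proof -
    have "[:F1:] dvd [:F2:] * w1" unfolding E2[symmetric] by (rule dvd_triv_left)
    then have "F1 dvd coeff ([:F2:] * w1) k" unfolding const_poly_dvd_iff by blast
    then show ?thesis by simp
  qed
  then have "[:F1:] dvd w1" unfolding const_poly_dvd_iff using cop by blast
  have F1': "[:F1:] \<noteq> 0" using F1 by simp
  from \<open>[:F1:] dvd w1\<close> obtain c where c1: "w1 = [:F1:] * c" by blast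
  have "[:F1:] * w2 = [:F1:] * ([:F2:] * c)" unfolding E2 c1 by (simp only: ac_simps)
  then have c2: "w2 = [:F2:] * c" by (rule mult_left_cancel[OF F1', THEN iffD1])
  have "[:F1:] * w3 = [:F1:] * ([:F3:] * c)" unfolding E3 c1 by (simp only: ac_simps)
  then have c3: "w3 = [:F3:] * c" by (rule mult_left_cancel[OF F1', THEN iffD1])
  note b' = deg_less_subst3_pderiv[OF b(1)] deg_less_subst3_pderiv[OF b(2)] deg_less_subst3_pderiv[OF b(3)]
  have n1: "n + n = d1 + (d2 + d3)" and n2: "n + n = d2 + (d3 + d1)" using deg by linarith+
  \<comment> \<open>One factor has \<open>x\<close>-degree below \<open>n - d2\<close>, the other at
    most \<open>n - d3\<close> despite the derivative, so the product stays below
    \<open>2 * n - d2 - d3 = d1\<close>.\<close>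
  have "deg_less (d2 + d3) (n + n) (subst3 w1)"
    unfolding w1_def s.hom_minus s.hom_mult
    by (rule deg_less_diff[OF deg_less_mult[OF b(2) b'(3)]
      deg_less_mult[OF b(3) b'(2), unfolded add.commute[of d3 d2]]])
  then have w1: "deg_less 0 d1 (subst3 w1)"
    using deg_less_cancel[of 0 "d2 + d3" d1 "subst3 w1"] n1 by simp
  have "deg_less (d3 + d1) (n + n) (subst3 w2)"
    unfolding w2_def s.hom_minus s.hom_mult
    by (rule deg_less_diff[OF deg_less_mult[OF b(3) b'(1)]
      deg_less_mult[OF b(1) b'(3), unfolded add.commute[of d1 d3]]])
  then have w2: "deg_less 0 d2 (subst3 w2)"
    using deg_less_cancel[of 0 "d3 + d1" d2 "subst3 w2"] n2 by simp
  \<comment> \<open>As \<open>w1\<close> and \<open>w2\<close> are \<open>c\<close> times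
    \<open>F1\<close> and \<open>F2\<close>, a nonzero \<open>c\<close> would push both
    \<open>F1\<close> and \<open>F2\<close> below their nominal degrees.\<close>
  have "c = 0"
  proof (rule ccontr)
    assume "c \<noteq> 0"
    then have "subst3 c \<noteq> 0" by (rule s0)
    then have "deg_less 0 d1 (subst2 F1)" "deg_less 0 d2 (subst2 F2)"
      using w1 w2 unfolding c1 c2 s.hom_mult subst3_const by (auto dest: deg_less_factor)
    then show False using inf by (simp add: deg_less_subst2_iff)
  qed
  then have w: "w1 = 0" "w2 = 0" "w3 = 0" using c1 c2 c3 by simp_all
  obtain h q1 q2 q3 where h: "h \<noteq> 0" and q: "p1 = h * q1" "p2 = h * q2" "p3 = h * q3"
    and prim: "\<And>a b. a dvd q1 * b \<Longrightarrow> a dvd q2 * b \<Longrightarrow> a dvd q3 * b \<Longrightarrow> a dvd b"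
    using primitive_triple[OF nz] by blast
  \<comment> \<open>The terms with \<open>pderiv h\<close> cancel, so the vanishing of the cross
    product passes to the primitive triple.\<close>
  have hq: "(h * a) * pderiv (h * b) - (h * b) * pderiv (h * a) = h * h * (a * pderiv b - b * pderiv a)"
    for a b by (simp add: pderiv_mult algebra_simps)
  have "h * h * (q2 * pderiv q3 - q3 * pderiv q2) = 0" "h * h * (q3 * pderiv q1 - q1 * pderiv q3) = 0"
    "h * h * (q1 * pderiv q2 - q2 * pderiv q1) = 0"
    using w unfolding w1_def w2_def w3_def q hq .
  then have e: "q2 * pderiv q3 = q3 * pderiv q2" "q3 * pderiv q1 = q1 * pderiv q3"
    "q1 * pderiv q2 = q2 * pderiv q1"
    using h by simp_all
  \<comment> \<open>By \<open>e\<close>, \<open>q1\<close> divides the product of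
    \<open>pderiv q1\<close> with each member of the primitive triple.\<close>
  have "q1 dvd pderiv q1" by (rule prim) (use e in \<open>metis dvd_triv_left\<close>)+
  then obtain G1 where G1: "q1 = [:G1:]" by (rule dvd_pderiv_imp_const)
  have "q2 dvd pderiv q2" by (rule prim) (use e in \<open>metis dvd_triv_left\<close>)+
  then obtain G2 where G2: "q2 = [:G2:]" by (rule dvd_pderiv_imp_const)
  have "q3 dvd pderiv q3" by (rule prim) (use e in \<open>metis dvd_triv_left\<close>)+
  then obtain G3 where G3: "q3 = [:G3:]" by (rule dvd_pderiv_imp_const)
  \<comment> \<open>Removing the nonzero factor \<open>h\<close> cannot raise the degree, so the
    bounds on the \<open>p\<close>'s pass to the \<open>G\<close>'s.\<close>
  have "tdeg_less d n G" if "deg_less d n (subst3 (h * [:G:]))" for d and G :: "'k poly poly"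
  proof -
    have "deg_less d n (subst2 G * subst3 h)"
      using that unfolding s.hom_mult subst3_const by (simp only: mult.commute)
    from deg_less_factor[OF this s0[OF h]] show ?thesis by (simp only: deg_less_subst2_iff)
  qed
  then have "tdeg_less d1 n G1" "tdeg_less d2 n G2" "tdeg_less d3 n G3" using b unfolding q G1 G2 G3 by blast+
  moreover have "G1 * F1 + G2 * F2 + G3 * F3 = 0"
  proof -
    have "h * ([:G1:] * [:F1:] + [:G2:] * [:F2:] + [:G3:] * [:F3:]) = 0"
      using syz unfolding q G1 G2 G3 by (simp only: distrib_left mult.assoc)
    also have "[:G1:] * [:F1:] + [:G2:] * [:F2:] + [:G3:] * [:F3:] = [:G1 * F1 + G2 * F2 + G3 * F3:]"
      by simp
    finally show ?thesis using h by simp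
  qed
  moreover have "G1 \<noteq> 0 \<or> G2 \<noteq> 0 \<or> G3 \<noteq> 0" using nz unfolding q G1 G2 G3 by auto
  ultimately show thesis using that by blast
qed

section \<open>From the generic line to a line over \<open>K\<close>\<close>

lemma comm_ring_hom_poly: "comm_ring_hom (\<lambda>p. poly p (a::'a::comm_ring_1))"
  by unfold_locales simp_all

text \<open>A field of characteristic zero is infinite, so a point with coordinates in
  \<open>K\<close> can be chosen one variable at a time.\<close>

lemma poly2_nonzero_point:
  fixes p :: "'k::field_char_0 poly poly"
  assumes "p \<noteq> 0"
  obtains u v where "poly (map_poly (\<lambda>r. poly r u) p) v \<noteq> 0"
proof -
  obtain k where "coeff p k \<noteq> 0" using assms by (metis leading_coeff_0_iff)
  then obtain u where "poly (coeff p k) u \<noteq> 0" using poly_all_0_iff_0 by blast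
  then have "coeff (map_poly (\<lambda>r. poly r u) p) k \<noteq> 0" by (simp add: coeff_map_poly)
  then have "map_poly (\<lambda>r. poly r u) p \<noteq> 0" by (metis coeff_0)
  then show thesis using that poly_all_0_iff_0 by blast
qed

lemma map_poly_eval_subst2:
  fixes F :: "'k::field_char_0 poly poly"
  shows "map_poly (\<lambda>c. poly (map_poly (\<lambda>r. poly r u) c) v) (subst2 F) = poly F [:v, u:]"
proof -
  let ?e = "\<lambda>c. poly (map_poly (\<lambda>r. poly r u) c) v"
  have e: "comm_ring_hom ?e" by (intro comm_ring_hom_eval comm_ring_hom_poly)
  show ?thesis
  proof (rule poly_hom_eqI[where f="\<lambda>F. map_poly ?e (subst2 F)" and g="\<lambda>F. poly F [:v, u:]"])
    show "comm_ring_hom (\<lambda>F. map_poly ?e (subst2 F))"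
      by (rule comm_ring_hom_comp[OF comm_ring_hom_map_poly[OF e] subst2_hom])
    show "comm_ring_hom (\<lambda>F. poly F [:v, u:])" by (rule comm_ring_hom_poly)
    show "map_poly ?e (subst2 [:r:]) = poly [:r:] [:v, u:]" for r
      unfolding subst2_const lift_coeff_def
      by (rule poly_eqI) (simp add: coeff_map_poly Polynomial.map_poly_pCons)
    show "map_poly ?e (subst2 [:0, 1:]) = poly [:0, 1:] [:v, u:]"
      unfolding subst2_X by (simp add: Polynomial.map_poly_pCons del: pCons_one)
  qed
qed

text \<open>If the determinant vanished on the generic line, a kernel element would descend to a
  syzygy excluded by \<open>nosyz\<close>. Hence it is a nonzero polynomial in \<open>u\<close> and
  \<open>v\<close>, and some specialisation keeps it nonzero.\<close>

lemma generic_line: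
  fixes F1 F2 F3 :: "'k::field_char_0 poly poly"
  assumes deg: "d1 \<le> n" "d2 \<le> n" "d3 \<le> n" "d1 + d2 + d3 = 2 * n"
    and F: "tdeg_less 0 (Suc d1) F1" "tdeg_less 0 (Suc d2) F2" "tdeg_less 0 (Suc d3) F3"
    and F1: "F1 \<noteq> 0"
    and cop: "\<And>h. F1 dvd F2 * h \<Longrightarrow> F1 dvd h"
    and inf: "\<not> (tdeg_less 0 d1 F1 \<and> tdeg_less 0 d2 F2)"
    and nosyz: "\<And>G1 G2 G3. tdeg_less d1 n G1 \<Longrightarrow> tdeg_less d2 n G2 \<Longrightarrow> tdeg_less d3 n G3 \<Longrightarrow>
      G1 * F1 + G2 * F2 + G3 * F3 = 0 \<Longrightarrow> G1 = 0 \<and> G2 = 0 \<and> G3 = 0"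
  obtains u v where
    "syz_det n d1 d2 (poly F1 [:v, u:]) (poly F2 [:v, u:]) (poly F3 [:v, u:]) \<noteq> 0"
proof -
  let ?D = "syz_det n d1 d2 (subst2 F1) (subst2 F2) (subst2 F3)"
  have "?D \<noteq> 0"
  proof
    assume "?D = 0"
    moreover have "deg_less 0 (Suc d1) (subst2 F1)" "deg_less 0 (Suc d2) (subst2 F2)" "deg_less 0 (Suc d3) (subst2 F3)"
      using F by (simp_all add: deg_less_subst2_iff)
    ultimately obtain g1 g2 g3 where g: "g1 \<noteq> 0 \<or> g2 \<noteq> 0 \<or> g3 \<noteq> 0"
      "deg_less d1 n g1" "deg_less d2 n g2" "deg_less d3 n g3" "g1 * subst2 F1 + g2 * subst2 F2 + g3 * subst2 F3 = 0"
      using syz_det_zero_imp[OF deg] by metis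
    interpret b: comm_ring_hom "back3 :: 'k poly poly poly \<Rightarrow> _" by (rule back3_hom)
    have "back3 (subst2 F) = [:F:]" for F :: "'k poly poly"
      using back3_subst3[of "[:F:]"] by (simp only: subst3_const)
    then have "back3 g1 * [:F1:] + back3 g2 * [:F2:] + back3 g3 * [:F3:] = 0"
      using arg_cong[OF g(5), of back3] by (simp only: b.hom_add b.hom_mult b.hom_zero)
    moreover have "back3 g1 \<noteq> 0 \<or> back3 g2 \<noteq> 0 \<or> back3 g3 \<noteq> 0"
    proof -
      have "subst3 (0 :: 'k poly poly poly) = 0" by (simp add: subst3_def)
      then show ?thesis using g(1) subst3_back3 by metis
    qed
    moreover have "deg_less d1 n (subst3 (back3 g1))" "deg_less d2 n (subst3 (back3 g2))" "deg_less d3 n (subst3 (back3 g3))"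
      using g by (simp_all add: subst3_back3)
    ultimately obtain G1 G2 G3 where "G1 \<noteq> 0 \<or> G2 \<noteq> 0 \<or> G3 \<noteq> 0"
      "tdeg_less d1 n G1" "tdeg_less d2 n G2" "tdeg_less d3 n G3" "G1 * F1 + G2 * F2 + G3 * F3 = 0"
      using syzygy_descends[OF deg(4) F1 cop inf] by metis
    then show False using nosyz by blast
  qed
  then obtain u v where "poly (map_poly (\<lambda>r. poly r u) ?D) v \<noteq> 0" by (rule poly2_nonzero_point)
  moreover have "comm_ring_hom (\<lambda>c. poly (map_poly (\<lambda>r. poly r u) c) v)"
    by (intro comm_ring_hom_eval comm_ring_hom_poly)
  note syz_det_hom[OF this, of n d1 d2 "subst2 F1" "subst2 F2" "subst2 F3", unfolded map_poly_eval_subst2]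
  ultimately show thesis using that by metis
qed

section \<open>Ternary forms\<close>

lemma UNIV_3_eq: "(UNIV :: 3 set) = {0, 1, 2}"
proof -
  have "card {0, 1, 2 :: 3} = 3" by simp
  then show ?thesis using card_subset_eq[of "UNIV :: 3 set" "{0, 1, 2}"] by simp
qed

lemma total_degree_eq: "total_degree m = Poly_Mapping.lookup m 0 + Poly_Mapping.lookup m 1 + Poly_Mapping.lookup m 2"
  unfolding total_degree_def UNIV_3_eq by simp

lemma exponent_eqI:
  fixes m m' :: "3 \<Rightarrow>\<^sub>0 nat"
  assumes "Poly_Mapping.lookup m 0 = Poly_Mapping.lookup m' 0" "Poly_Mapping.lookup m 2 = Poly_Mapping.lookup m' 2"
    and "total_degree m = total_degree m'"
  shows "m = m'"
proof (rule poly_mapping_eqI)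
  fix k :: 3
  have "k \<in> {0, 1, 2}" using UNIV_3_eq by blast
  then show "Poly_Mapping.lookup m k = Poly_Mapping.lookup m' k" using assms by (auto simp: total_degree_eq)
qed

lemma total_degree_add: "total_degree (m + m') = total_degree m + total_degree m'"
  by (simp add: total_degree_eq lookup_add)

lemma poly_mapping_sum_single: "p = (\<Sum>m\<in>Poly_Mapping.keys p. Poly_Mapping.single m (Poly_Mapping.lookup p m))"
  by (rule poly_mapping_eqI)
    (simp add: lookup_sum lookup_single when_def not_in_keys_iff_lookup_eq_zero)

lemma poly_mapping_induct_single [case_names single add]:
  fixes p :: "'a \<Rightarrow>\<^sub>0 'b::comm_monoid_add"
  assumes single: "\<And>m c. P (Poly_Mapping.single m c)" and add: "\<And>p q. P p \<Longrightarrow> P q \<Longrightarrow> P (p + q)"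
  shows "P p"
proof -
  have "P (\<Sum>m\<in>A. Poly_Mapping.single m (Poly_Mapping.lookup p m))" if "finite A" for A
    using that
  proof induction
    case empty
    show ?case using single[of undefined 0] by simp
  next
    case (insert m A)
    then show ?case by (simp add: add single)
  qed
  then show ?thesis using poly_mapping_sum_single[of p] by (metis finite_keys)
qed

definition homog :: "nat \<Rightarrow> nat \<Rightarrow> 'k::field_char_0 poly3 \<Rightarrow> bool" where
  "homog d n G \<longleftrightarrow> (\<forall>m\<in>Poly_Mapping.keys G. total_degree m + d = n)"

lemma forms_iff_homog: "G \<in> forms n \<longleftrightarrow> homog 0 n G"
  by (simp add: forms_def homog_def)

lemma homog_0 [simp]: "homog d n 0" by (simp add: homog_def)

lemma homog_single: "c = 0 \<or> total_degree m + d = n \<Longrightarrow> homog d n (Poly_Mapping.single m c)"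
  by (auto simp: homog_def)

lemma homog_add: "homog d n p \<Longrightarrow> homog d n q \<Longrightarrow> homog d n (p + q)"
  unfolding homog_def using Poly_Mapping.keys_add[of p q] by blast

lemma homog_uminus: "homog d n p \<Longrightarrow> homog d n (- p)"
  by (simp add: homog_def keys_def)

lemma homog_diff: "homog d n p \<Longrightarrow> homog d n q \<Longrightarrow> homog d n (p - q)"
  using homog_add[of d n p "- q"] homog_uminus[of d n q] by simp

lemma homog_sum: "(\<And>x. x \<in> A \<Longrightarrow> homog d n (f x)) \<Longrightarrow> homog d n (sum f A)"
  by (induction A rule: infinite_finite_induct) (auto intro: homog_add)

lemma homog_mult: "homog d n p \<Longrightarrow> homog e k q \<Longrightarrow> homog (d + e) (n + k) (p * q)"
  unfolding homog_def using Poly_Mapping.keys_mult[of p q] by (fastforce simp: total_degree_add)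

lemma homog_shift: "homog (d + e) (n + e) p \<longleftrightarrow> homog d n p"
  by (simp add: homog_def flip: add.assoc)

lemma homog_mult_form: "homog d n G \<Longrightarrow> homog 0 d F \<Longrightarrow> homog 0 n (G * F)"
  using homog_mult[of d n G 0 d F] homog_shift[of 0 d n "G * F"] by simp

lemma homog_less_imp_zero: "homog d n G \<Longrightarrow> n < d \<Longrightarrow> G = 0"
  by (auto simp: homog_def simp flip: keys_eq_empty)

text \<open>The substitution \<open>y = 1\<close>, where \<open>x, y, z\<close> are the variables \<open>0, 1, 2\<close>.\<close>

definition dehom :: "'k::field_char_0 poly3 \<Rightarrow> 'k poly poly" where
  "dehom p = (\<Sum>m\<in>Poly_Mapping.keys p.
     monom (monom (Poly_Mapping.lookup p m) (Poly_Mapping.lookup m 0)) (Poly_Mapping.lookup m 2))"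

lemma dehom_add: "dehom (p + q) = dehom p + dehom q"
  unfolding dehom_def by (rule setsum_keys_plus_distrib) (simp_all add: add_monom)

lemma dehom_single: "dehom (Poly_Mapping.single m c) =
    monom (monom c (Poly_Mapping.lookup m 0)) (Poly_Mapping.lookup m 2)"
  by (simp add: dehom_def)

lemma dehom_mult: "dehom (p * q) = dehom p * dehom q"
proof (induction p rule: poly_mapping_induct_single)
  case (single m c)
  show ?case
    by (induction q rule: poly_mapping_induct_single)
      (simp_all add: dehom_add distrib_left mult_single dehom_single mult_monom lookup_add)
qed (simp add: dehom_add distrib_right)

lemma dehom_hom: "comm_ring_hom dehom"
proof
  show "dehom 1 = (1 :: 'a poly poly)"
    using dehom_single[of 0 "1 :: 'a"] by (simp add: monom_0 pCons_one)
  show "dehom 0 = (0 :: 'a poly poly)" by (simp add: dehom_def)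
qed (simp_all add: dehom_add dehom_mult)

text \<open>In a fixed degree the exponent of \<open>y\<close> is determined by those of
  \<open>x\<close> and \<open>z\<close>, so distinct monomials of \<open>G\<close> do not
  collide.\<close>

lemma coeff_dehom:
  assumes "homog d n G" "total_degree m + d = n"
  shows "coeff (coeff (dehom G) (Poly_Mapping.lookup m 2)) (Poly_Mapping.lookup m 0) = Poly_Mapping.lookup G m"
proof -
  have *: "Poly_Mapping.lookup m' 2 = Poly_Mapping.lookup m 2 \<and> Poly_Mapping.lookup m' 0 = Poly_Mapping.lookup m 0 \<longleftrightarrow> m' = m"
    if "m' \<in> Poly_Mapping.keys G" for m'
    using that assms exponent_eqI[of m' m] by (auto simp: homog_def)
  have "coeff (coeff (dehom G) (Poly_Mapping.lookup m 2)) (Poly_Mapping.lookup m 0) =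
    (\<Sum>m'\<in>Poly_Mapping.keys G. if m' = m then Poly_Mapping.lookup G m' else 0)"
    unfolding dehom_def coeff_sum
    by (rule sum.cong[OF refl]) (use * in \<open>auto\<close>)
  also have "\<dots> = Poly_Mapping.lookup G m"
    by (simp add: not_in_keys_iff_lookup_eq_zero)
  finally show ?thesis .
qed

lemma dehom_eq_0_imp: "homog d n G \<Longrightarrow> dehom G = 0 \<Longrightarrow> G = 0"
  by (rule poly_mapping_eqI) (metis coeff_0 coeff_dehom homog_def lookup_not_eq_zero_eq_in_keys lookup_zero)

lemma dehom_inj: "homog d n G \<Longrightarrow> homog d n H \<Longrightarrow> dehom G = dehom H \<Longrightarrow> G = H"
proof -
  interpret comm_ring_hom "dehom :: 'a poly3 \<Rightarrow> _" by (rule dehom_hom)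
  show "homog d n G \<Longrightarrow> homog d n H \<Longrightarrow> dehom G = dehom H \<Longrightarrow> G = H"
    using dehom_eq_0_imp[of d n "G - H"] homog_diff[of d n G H] by (simp add: hom_minus)
qed

lemma tdeg_less_add: "tdeg_less d n p \<Longrightarrow> tdeg_less d n q \<Longrightarrow> tdeg_less d n (p + q)" for p :: "'a::comm_monoid_add poly poly"
  unfolding tdeg_less_def by (metis add.right_neutral coeff_add)

lemma tdeg_less_0 [simp]: "tdeg_less d n 0" by (simp add: tdeg_less_def)

lemma tdeg_less_sum:
  fixes f :: "'b \<Rightarrow> 'a::comm_monoid_add poly poly"
  assumes "\<And>c. c \<in> A \<Longrightarrow> tdeg_less d n (f c)"
  shows "tdeg_less d n (sum f A)"
  using assms by (induction A rule: infinite_finite_induct) (auto intro: tdeg_less_add)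

lemma tdeg_less_dehom: "homog d n G \<Longrightarrow> tdeg_less d (Suc n) (dehom G)"
  unfolding dehom_def
  by (rule tdeg_less_sum) (auto simp: tdeg_less_def homog_def total_degree_eq)

lemma ex_dehom:
  assumes "tdeg_less d (Suc n) q"
  obtains G where "homog d n G" "dehom G = q"
proof -
  \<comment> \<open>The variable \<open>y\<close> pads each monomial to degree \<open>n - d\<close>;
    the subtraction is exact wherever the coefficient is nonzero.\<close>
  define mon where "mon j k = Poly_Mapping.single (0::3) j + Poly_Mapping.single 1 (n - (j + k + d)) + Poly_Mapping.single 2 k"
    for j k
  have l: "Poly_Mapping.lookup (mon j k) 0 = j" "Poly_Mapping.lookup (mon j k) 2 = k"
    "Poly_Mapping.lookup (mon j k) 1 = n - (j + k + d)" for j k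
    by (simp_all add: mon_def lookup_add lookup_single)
  interpret comm_ring_hom "dehom :: 'a poly3 \<Rightarrow> _" by (rule dehom_hom)
  define G where "G = (\<Sum>k\<le>degree q. \<Sum>j\<le>degree (coeff q k). Poly_Mapping.single (mon j k) (coeff (coeff q k) j))"
  have "homog d n (Poly_Mapping.single (mon j k) (coeff (coeff q k) j))" for j k
  proof (rule homog_single, cases "coeff (coeff q k) j = 0")
    case False
    then have "j + k + d < Suc n" using assms by (simp add: tdeg_less_def)
    then show "coeff (coeff q k) j = 0 \<or> total_degree (mon j k) + d = n"
      by (simp add: total_degree_eq l)
  qed simp
  then have "homog d n G" unfolding G_def by (intro homog_sum)
  moreover have "dehom G = q"
  proof -
    have "dehom G = (\<Sum>k\<le>degree q. \<Sum>j\<le>degree (coeff q k). monom (monom (coeff (coeff q k) j) j) k)"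
      by (simp add: G_def hom_sum dehom_single l)
    also have "\<dots> = (\<Sum>k\<le>degree q. monom (\<Sum>j\<le>degree (coeff q k). monom (coeff (coeff q k) j) j) k)"
      by (simp add: monom_sum)
    also have "\<dots> = q" by (simp add: poly_as_sum_of_monoms)
    finally show ?thesis .
  qed
  ultimately show thesis using that by blast
qed

section \<open>Restriction to a line\<close>

lemma tdeg_less_iff_deg_less: "tdeg_less d n q \<longleftrightarrow> (\<forall>k. deg_less (k + d) n (coeff q k))"
  by (simp add: tdeg_less_def deg_less_def add.assoc)

text \<open>The divisor is monic in \<open>z\<close>: the product has \<open>z\<close>-coefficient
  \<open>coeff q k - [:a, b:] * coeff q (Suc k)\<close> at \<open>Suc k\<close>, so the bounds on
  the coefficients of \<open>q\<close> follow by descending induction from the top one.\<close>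

lemma tdeg_less_linear_factor:
  fixes q :: "'k::comm_ring_1 poly poly"
  assumes "tdeg_less d n ([:- [:a, b:], 1:] * q)"
  shows "tdeg_less (Suc d) n q"
proof -
  have "deg_less (k + Suc d) n (coeff q k)" for k
  proof (induction "Suc (degree q) - k" arbitrary: k rule: less_induct)
    case less
    show ?case
    proof (cases "k > degree q")
      case True
      then show ?thesis by (simp add: coeff_eq_0)
    next
      case False
      then have "deg_less (Suc k + Suc d) n (coeff q (Suc k))" by (intro less) simp
      then have "deg_less (k + Suc d) n ([:a, b:] * coeff q (Suc k))"
        by (intro deg_less_linear_mult) simp
      moreover have "deg_less (Suc k + d) n (coeff ([:- [:a, b:], 1:] * q) (Suc k))"
        using assms unfolding tdeg_less_iff_deg_less by blast
      then have "deg_less (k + Suc d) n (coeff q k - [:a, b:] * coeff q (Suc k))"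
        by (simp del: minus_pCons)
      ultimately have "deg_less (k + Suc d) n (coeff q k - [:a, b:] * coeff q (Suc k) + [:a, b:] * coeff q (Suc k))"
        by (rule deg_less_add[rotated])
      then show ?thesis by (simp only: diff_add_cancel)
    qed
  qed
  then show ?thesis unfolding tdeg_less_iff_deg_less by blast
qed

text \<open>The form \<open>z - u x - v y\<close> cuts out the line; its class is the candidate
  Lefschetz element.\<close>

definition linear_form :: "'k::field_char_0 \<Rightarrow> 'k \<Rightarrow> 'k poly3" where
  "linear_form u v = Poly_Mapping.single (Poly_Mapping.single 2 1) 1
     - Poly_Mapping.single (Poly_Mapping.single 0 1) u - Poly_Mapping.single (Poly_Mapping.single 1 1) v"

definition on_line :: "'k::field_char_0 \<Rightarrow> 'k \<Rightarrow> 'k poly3 \<Rightarrow> 'k poly" where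
  "on_line u v G = poly (dehom G) [:v, u:]"

lemma on_line_hom: "comm_ring_hom (on_line u v)"
  unfolding on_line_def[abs_def] by (rule comm_ring_hom_comp[OF comm_ring_hom_poly dehom_hom])

lemma homog_linear_form: "homog 0 1 (linear_form u v)"
  unfolding linear_form_def
  by (intro homog_diff homog_single) (simp_all add: total_degree_eq lookup_single)

lemma dehom_linear_form: "dehom (linear_form u v) = [:- [:v, u:], 1:]"
proof -
  interpret comm_ring_hom "dehom :: 'a poly3 \<Rightarrow> _" by (rule dehom_hom)
  show ?thesis
    unfolding linear_form_def hom_minus dehom_single
    by (simp add: lookup_single monom_altdef one_pCons del: pCons_one)
qed

lemma linear_form_nonzero: "linear_form u v \<noteq> 0"
proof
  interpret comm_ring_hom "dehom :: 'a poly3 \<Rightarrow> _" by (rule dehom_hom)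
  assume "linear_form u v = 0"
  then have "[:- [:v, u:], 1:] = 0" using dehom_linear_form[of u v] by simp
  then show False by simp
qed

lemma on_line_linear_form: "on_line u v (linear_form u v) = 0"
  by (simp add: on_line_def dehom_linear_form)

lemma homog_mult_linear_form: "homog (Suc d) n H \<Longrightarrow> homog d n (linear_form u v * H)"
  using homog_mult[OF homog_linear_form, of "Suc d" n H u v] homog_shift[of d 1 n "linear_form u v * H"] by simp

text \<open>Factor theorem in \<open>z\<close> over \<open>K[x]\<close>; the degree bound on the
  quotient allows it to be homogenised again.\<close>

lemma on_line_eq_0_imp:
  assumes "homog d n G" "on_line u v G = 0"
  obtains H where "homog (Suc d) n H" "G = linear_form u v * H"
proof -
  have "[:- [:v, u:], 1:] dvd dehom G"
    using assms(2) unfolding on_line_def poly_eq_0_iff_dvd .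
  then obtain q where q: "dehom G = [:- [:v, u:], 1:] * q" by (elim dvdE)
  have "tdeg_less (Suc d) (Suc n) q"
    using tdeg_less_dehom[OF assms(1)] unfolding q by (rule tdeg_less_linear_factor)
  then obtain H where H: "homog (Suc d) n H" "dehom H = q" by (rule ex_dehom)
  have "G = linear_form u v * H"
    by (rule dehom_inj[OF assms(1) homog_mult_linear_form[OF H(1)]])
      (simp only: dehom_mult dehom_linear_form H(2) q)
  then show thesis using that H(1) by blast
qed

lemma ex_on_line:
  assumes "deg_less d (Suc n) g"
  obtains G where "homog d n G" "on_line u v G = g"
proof -
  have "tdeg_less d (Suc n) [:g:]" using assms by (simp add: tdeg_less_pCons)
  then obtain G where "homog d n G" "dehom G = [:g:]" by (rule ex_dehom)
  then show thesis using that by (simp add: on_line_def)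
qed

lemma deg_less_on_line: "homog d n G \<Longrightarrow> deg_less d (Suc n) (on_line u v G)"
  using deg_less_line[OF comm_ring_hom_id tdeg_less_dehom, of d n G v u]
  by (simp add: on_line_def map_poly_idI)

section \<open>Homogeneous components and homogeneous combinations\<close>

definition part :: "nat \<Rightarrow> nat \<Rightarrow> 'k::field_char_0 poly3 \<Rightarrow> 'k poly3" where
  "part d n p = (\<Sum>m\<in>{m\<in>Poly_Mapping.keys p. total_degree m + d = n}. Poly_Mapping.single m (Poly_Mapping.lookup p m))"

lemma lookup_part: "Poly_Mapping.lookup (part d n p) m = (if total_degree m + d = n then Poly_Mapping.lookup p m else 0)"
  by (simp add: part_def lookup_sum lookup_single when_def not_in_keys_iff_lookup_eq_zero)

lemma homog_part: "homog d n (part d n p)"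
  by (auto simp: homog_def in_keys_iff lookup_part split: if_splits)

lemma part_add: "part d n (p + q) = part d n p + part d n q"
  by (rule poly_mapping_eqI) (simp add: lookup_part lookup_add)

lemma part_homog: "homog 0 k p \<Longrightarrow> part d n p = (if k + d = n then p else 0)"
  by (rule poly_mapping_eqI) (auto simp: lookup_part homog_def in_keys_iff)

lemma part_mult: "homog 0 d F \<Longrightarrow> part 0 n (p * F) = part d n p * F"
proof (induction p rule: poly_mapping_induct_single)
  case (single m c)
  have s: "homog 0 (total_degree m) (Poly_Mapping.single m c)" by (simp add: homog_single)
  have "homog 0 (total_degree m + d) (Poly_Mapping.single m c * F)"
    using homog_mult[OF s single] by simp
  then show ?case using part_homog[OF s, of d n] by (simp add: part_homog)
qed (simp add: part_add distrib_right)

text \<open>The component of degree \<open>n\<close> of the whole identity replaces the coefficients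
  by their homogeneous components.\<close>

lemma homog_combination:
  assumes "homog 0 d1 F1" "homog 0 d2 F2" "homog 0 d3 F3" "homog 0 n h" "h = a * F1 + b * F2 + c * F3"
  obtains a' b' c' where "homog d1 n a'" "homog d2 n b'" "homog d3 n c'" "h = a' * F1 + b' * F2 + c' * F3"
proof -
  have "h = part 0 n h" using part_homog[OF assms(4), of 0 n] by simp
  also have "\<dots> = part d1 n a * F1 + part d2 n b * F2 + part d3 n c * F3"
    unfolding assms(5) part_add
    by (simp only: part_mult[OF assms(1)] part_mult[OF assms(2)] part_mult[OF assms(3)])
  finally show thesis using that homog_part by blast
qed

lemma homog_dvd_less:
  assumes "homog 0 e p" "homog 0 d F" "F dvd p" "e < d"
  shows "p = 0"
proof -
  obtain a where "p = a * F" using assms(3) by (metis dvdE mult.commute)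
  then obtain a' b' c' where "homog d e a'" "p = a' * F"
    using homog_combination[of d F 0 0 0 0 e p a 0 0] assms(1,2) by (metis add_0_right homog_0 mult_zero_right)
  then show ?thesis using homog_less_imp_zero assms(4) by (metis mult_zero_left)
qed

section \<open>From line conditions to the weak Lefschetz property\<close>

lemma carrier_type_ring [simp]: "carrier (ring_of_type_algebra :: 'a::comm_ring_1 ring) = UNIV"
  and mult_type_ring [simp]: "x \<otimes>\<^bsub>ring_of_type_algebra\<^esub> y = x * (y :: 'a)"
  and add_type_ring [simp]: "x \<oplus>\<^bsub>ring_of_type_algebra\<^esub> y = x + (y :: 'a)"
  and zero_type_ring [simp]: "\<zero>\<^bsub>ring_of_type_algebra\<^esub> = (0 :: 'a)"
  by (simp_all add: ring_of_type_algebra_def)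

lemma a_inv_type_ring: "\<ominus>\<^bsub>ring_of_type_algebra\<^esub> x = - (x :: 'a::comm_ring_1)"
proof -
  interpret R: ring "ring_of_type_algebra :: 'a ring" by (rule ring_from_type_algebra)
  show ?thesis by (rule R.minus_equality) simp_all
qed

lemma ideal_type_ringI:
  fixes J :: "'a::comm_ring_1 set"
  assumes "0 \<in> J" "\<And>x y. x \<in> J \<Longrightarrow> y \<in> J \<Longrightarrow> x + y \<in> J" "\<And>x r. x \<in> J \<Longrightarrow> r * x \<in> J"
  shows "ideal J (ring_of_type_algebra :: 'a ring)"
proof (rule idealI)
  show "ring (ring_of_type_algebra :: 'a ring)" by (rule ring_from_type_algebra)
  show "subgroup J (add_monoid (ring_of_type_algebra :: 'a ring))"
  proof
    fix x assume "x \<in> J"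
    then have "- x \<in> J" using assms(3)[of x "- 1"] by simp
    then show "inv\<^bsub>add_monoid ring_of_type_algebra\<^esub> x \<in> J"
      using a_inv_type_ring[of x] by (simp add: a_inv_def)
  qed (use assms in auto)
qed (use assms in \<open>auto simp: mult.commute\<close>)

lemma genideal_empty: "Idl\<^bsub>ring_of_type_algebra\<^esub> {} = {0 :: 'a::comm_ring_1}"
proof -
  interpret R: ring "ring_of_type_algebra :: 'a ring" by (rule ring_from_type_algebra)
  have "ideal {0 :: 'a} ring_of_type_algebra" by (rule ideal_type_ringI) auto
  then have "Idl\<^bsub>ring_of_type_algebra\<^esub> {} \<subseteq> {0 :: 'a}" by (rule R.genideal_minimal) simp
  moreover have "0 \<in> Idl\<^bsub>ring_of_type_algebra\<^esub> ({} :: 'a set)"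
    using additive_subgroup.zero_closed[OF ideal.axioms(1)[OF R.genideal_ideal[of "{}"]]] by simp
  ultimately show ?thesis by blast
qed

lemma genideal_3:
  fixes a b c :: "'a::comm_ring_1"
  shows "Idl\<^bsub>ring_of_type_algebra\<^esub> {a, b, c} = {r * a + s * b + t * c | r s t. True}" (is "?I = ?J")
proof
  interpret R: ring "ring_of_type_algebra :: 'a ring" by (rule ring_from_type_algebra)
  have J: "r * a + s * b + t * c \<in> ?J" for r s t by blast
  have "ideal ?J ring_of_type_algebra"
  proof (rule ideal_type_ringI)
    show "0 \<in> ?J" using J[of 0 0 0] by simp
    show "x + y \<in> ?J" if mem: "x \<in> ?J" "y \<in> ?J" for x y
    proof -
      obtain r s t where x: "x = r * a + s * b + t * c" using mem(1) by blast
      obtain r' s' t' where y: "y = r' * a + s' * b + t' * c" using mem(2) by blast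
      have "x + y = (r + r') * a + (s + s') * b + (t + t') * c" by (simp add: x y algebra_simps)
      then show ?thesis by blast
    qed
    show "q * x \<in> ?J" if mem: "x \<in> ?J" for x q
    proof -
      obtain r s t where "x = r * a + s * b + t * c" using mem by blast
      then have "q * x = (q * r) * a + (q * s) * b + (q * t) * c" by (simp add: algebra_simps)
      then show ?thesis by blast
    qed
  qed
  moreover have "{a, b, c} \<subseteq> ?J" using J[of 1 0 0] J[of 0 1 0] J[of 0 0 1] by auto
  ultimately show "?I \<subseteq> ?J" by (rule R.genideal_minimal)
  have I: "ideal ?I ring_of_type_algebra" by (rule R.genideal_ideal) simp
  have "{a, b, c} \<subseteq> ?I" by (rule R.genideal_self) simp
  then show "?J \<subseteq> ?I"
    using additive_subgroup.a_closed[OF ideal.axioms(1)[OF I]] ideal.I_l_closed[OF I] by auto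
qed

lemma genideal_1: "Idl\<^bsub>ring_of_type_algebra\<^esub> {a} = {x. a dvd (x :: 'a::comm_ring_1)}"
proof -
  have "(\<exists>r s t. x = r * a + s * a + t * a) \<longleftrightarrow> a dvd x" for x
  proof
    assume "a dvd x"
    then obtain k where "x = a * k" by (elim dvdE)
    then have "x = k * a + 0 * a + 0 * a" by (simp add: mult.commute)
    then show "\<exists>r s t. x = r * a + s * a + t * a" by blast
  qed auto
  then show ?thesis using genideal_3[of a a a] by simp
qed

lemma genideal_2:
  fixes a b :: "'a::comm_ring_1"
  shows "Idl\<^bsub>ring_of_type_algebra\<^esub> {a, b} = {x. \<exists>r s. x = r * a + s * b}"
proof -
  have "(\<exists>r s t. x = r * a + s * b + t * b) \<longleftrightarrow> (\<exists>r s. x = r * a + s * b)" for x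
  proof
    assume "\<exists>r s t. x = r * a + s * b + t * b"
    then obtain r s t where "x = r * a + s * b + t * b" by blast
    then have "x = r * a + (s + t) * b" by (simp add: algebra_simps)
    then show "\<exists>r s. x = r * a + s * b" by blast
  next
    assume "\<exists>r s. x = r * a + s * b"
    then obtain r s where "x = r * a + s * b" by blast
    then have "x = r * a + s * b + 0 * b" by simp
    then show "\<exists>r s t. x = r * a + s * b + t * b" by blast
  qed
  then show ?thesis using genideal_3[of a b b] by simp
qed

lemma coset_eq_iff:
  fixes I :: "'a::comm_ring_1 set"
  assumes "ideal I ring_of_type_algebra"
  shows "I +>\<^bsub>ring_of_type_algebra\<^esub> p = I +>\<^bsub>ring_of_type_algebra\<^esub> q \<longleftrightarrow> p - q \<in> I"
  using ring.quotient_eq_iff_same_a_r_cos[OF ring_from_type_algebra assms, of p q]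
  by (simp add: a_minus_def a_inv_type_ring)

lemma coset_mult:
  fixes I :: "'a::comm_ring_1 set"
  assumes "ideal I ring_of_type_algebra"
  shows "(I +>\<^bsub>ring_of_type_algebra\<^esub> p) \<otimes>\<^bsub>ring_of_type_algebra Quot I\<^esub> (I +>\<^bsub>ring_of_type_algebra\<^esub> q)
    = I +>\<^bsub>ring_of_type_algebra\<^esub> (p * q)"
  using ideal.rcoset_mult_add[OF assms, of p q] by (simp add: FactRing_def)

section \<open>Injectivity and surjectivity on a line\<close>

definition line_inj :: "nat \<Rightarrow> nat \<Rightarrow> nat \<Rightarrow> nat \<Rightarrow> 'a::comm_ring_1 poly \<Rightarrow> 'a poly \<Rightarrow> 'a poly \<Rightarrow> bool" where
  "line_inj n d1 d2 d3 f1 f2 f3 \<longleftrightarrow> (\<forall>g1 g2 g3. deg_less d1 n g1 \<longrightarrow> deg_less d2 n g2 \<longrightarrow> deg_less d3 n g3 \<longrightarrow>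
     g1 * f1 + g2 * f2 + g3 * f3 = 0 \<longrightarrow> g1 = 0 \<and> g2 = 0 \<and> g3 = 0)"

definition line_surj :: "nat \<Rightarrow> nat \<Rightarrow> nat \<Rightarrow> nat \<Rightarrow> 'a::comm_ring_1 poly \<Rightarrow> 'a poly \<Rightarrow> 'a poly \<Rightarrow> bool" where
  "line_surj n d1 d2 d3 f1 f2 f3 \<longleftrightarrow> (\<forall>h. deg_less 0 n h \<longrightarrow>
     (\<exists>g1 g2 g3. deg_less d1 n g1 \<and> deg_less d2 n g2 \<and> deg_less d3 n g3 \<and> h = g1 * f1 + g2 * f2 + g3 * f3))"

lemma deg_less_mono: "deg_less d n g \<Longrightarrow> n \<le> n' \<Longrightarrow> deg_less d n' g"
  unfolding deg_less_def by (metis less_le_trans)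

text \<open>A polynomial is its constant term plus \<open>x\<close> times one of smaller degree, and
  both are already reached in the bound \<open>n\<close>; the constant needs
  \<open>0 < n\<close>.\<close>

lemma line_surj_Suc:
  fixes f1 f2 f3 :: "'a::comm_ring_1 poly"
  assumes "0 < n" "line_surj n d1 d2 d3 f1 f2 f3"
  shows "line_surj (Suc n) d1 d2 d3 f1 f2 f3"
  unfolding line_surj_def
proof (intro allI impI)
  fix h :: "'a poly" assume h: "deg_less 0 (Suc n) h"
  obtain c k where hk: "h = pCons c k" by (cases h) auto
  have "deg_less 0 n [:c:]" "deg_less 0 n k" using h assms(1) deg_less_cancel[of 0 1 n k]
    unfolding hk by (simp_all add: deg_less_pCons)
  then obtain g1 g2 g3 g1' g2' g3' where
    g: "deg_less d1 n g1" "deg_less d2 n g2" "deg_less d3 n g3" "[:c:] = g1 * f1 + g2 * f2 + g3 * f3"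
    and g': "deg_less d1 n g1'" "deg_less d2 n g2'" "deg_less d3 n g3'" "k = g1' * f1 + g2' * f2 + g3' * f3"
    using assms(2) unfolding line_surj_def by metis
  have b: "deg_less d (Suc n) (g + [:0, 1:] * g')" if "deg_less d n g" "deg_less d n g'" for d and g g' :: "'a poly"
  proof (rule deg_less_add)
    show "deg_less d (Suc n) g" using that(1) by (rule deg_less_mono) simp
    have "deg_less (Suc d) (Suc n) g'" using that(2) by (simp add: deg_less_def)
    then show "deg_less d (Suc n) ([:0, 1:] * g')" by (rule deg_less_linear_mult)
  qed
  have "h = [:c:] + [:0, 1:] * k" unfolding hk by simp
  also have "\<dots> = (g1 + [:0, 1:] * g1') * f1 + (g2 + [:0, 1:] * g2') * f2 + (g3 + [:0, 1:] * g3') * f3"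
    unfolding g(4) g'(4) by (simp only: distrib_left distrib_right ac_simps)
  finally show "\<exists>g1 g2 g3. deg_less d1 (Suc n) g1 \<and> deg_less d2 (Suc n) g2 \<and> deg_less d3 (Suc n) g3 \<and>
      h = g1 * f1 + g2 * f2 + g3 * f3"
    using b[OF g(1) g'(1)] b[OF g(2) g'(2)] b[OF g(3) g'(3)] by blast
qed

lemma line_surj_mono:
  assumes "0 < n" "line_surj n d1 d2 d3 f1 f2 f3" "n \<le> n'"
  shows "line_surj n' d1 d2 d3 f1 f2 f3"
  using assms(3)
proof (induction n' rule: dec_induct)
  case (step m)
  then show ?case using assms(1) by (intro line_surj_Suc) auto
qed (rule assms(2))

text \<open>A form of degree \<open>i + 1\<close> restricts to a polynomial of degree below
  \<open>i + 2\<close>. So multiplication out of degree \<open>i\<close> is injective if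
  \<open>i + 2 \<le> n\<close> and surjective if \<open>n' \<le> i + 2\<close>; by
  \<open>n' \<le> Suc n\<close> no degree is left out.\<close>

lemma wlp_if_line:
  fixes F1 F2 F3 :: "'k::field_char_0 poly3"
  assumes F: "homog 0 d1 F1" "homog 0 d2 F2" "homog 0 d3 F3"
    and n: "0 < n'" "n' \<le> Suc n"
    and inj: "line_inj n d1 d2 d3 (on_line u v F1) (on_line u v F2) (on_line u v F3)"
    and surj: "line_surj n' d1 d2 d3 (on_line u v F1) (on_line u v F2) (on_line u v F3)"
  defines "I \<equiv> Idl\<^bsub>poly3_ring\<^esub> {F1, F2, F3}"
  shows "weak_lefschetz_property (poly3_ring Quot I) (quot_component I)"
proof -
  let ?l = "linear_form u v"
  let ?c = "\<lambda>p. I +>\<^bsub>poly3_ring\<^esub> p"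
  interpret R: ring "poly3_ring :: 'k poly3 ring" by (rule ring_from_type_algebra)
  have I: "ideal I poly3_ring" unfolding I_def by (rule R.genideal_ideal) simp
  interpret L: comm_ring_hom "on_line u v" by (rule on_line_hom)
  have memI: "x \<in> I \<longleftrightarrow> (\<exists>a b c. x = a * F1 + b * F2 + c * F3)" for x
    unfolding I_def genideal_3 by blast
  have inj': "inj_on (\<lambda>a. ?c ?l \<otimes>\<^bsub>poly3_ring Quot I\<^esub> a) (quot_component I i)" if "i + 2 \<le> n" for i
  proof (rule inj_onI)
    fix x y assume "x \<in> quot_component I i" "y \<in> quot_component I i"
    then obtain p q where p: "homog 0 i p" "x = ?c p" and q: "homog 0 i q" "y = ?c q"
      unfolding quot_component_def by (auto simp: forms_iff_homog)
    assume "?c ?l \<otimes>\<^bsub>poly3_ring Quot I\<^esub> x = ?c ?l \<otimes>\<^bsub>poly3_ring Quot I\<^esub> y"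
    then have "?l * (p - q) \<in> I" by (simp add: p q coset_mult[OF I] coset_eq_iff[OF I] right_diff_distrib)
    then obtain a b c where "?l * (p - q) = a * F1 + b * F2 + c * F3" unfolding memI by blast
    moreover have "homog 0 (1 + i) (?l * (p - q))"
      using homog_mult[OF homog_linear_form homog_diff[OF p(1) q(1)], of u v] by simp
    ultimately obtain a b c where abc: "homog d1 (1 + i) a" "homog d2 (1 + i) b" "homog d3 (1 + i) c"
      "?l * (p - q) = a * F1 + b * F2 + c * F3"
      using homog_combination[OF F] by metis
    from arg_cong[OF abc(4), of "on_line u v"]
    have "on_line u v a * on_line u v F1 + on_line u v b * on_line u v F2 + on_line u v c * on_line u v F3 = 0"
      by (simp add: L.hom_add L.hom_mult on_line_linear_form)
    moreover have "deg_less d n (on_line u v a)" if "homog d (1 + i) a" for d a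
      using deg_less_on_line[OF that] by (rule deg_less_mono) (use \<open>i + 2 \<le> n\<close> in simp)
    ultimately have "on_line u v a = 0" "on_line u v b = 0" "on_line u v c = 0"
      using inj abc(1-3) unfolding line_inj_def by blast+
    \<comment> \<open>Coefficients that vanish on the line are multiples of \<open>?l\<close>, which
      then cancels from the whole equation.\<close>
    then obtain a' b' c' where "a = ?l * a'" "b = ?l * b'" "c = ?l * c'"
      using on_line_eq_0_imp abc(1-3) by metis
    then have "?l * (p - q) = ?l * (a' * F1 + b' * F2 + c' * F3)"
      using abc(4) by (simp add: algebra_simps)
    then have "p - q = a' * F1 + b' * F2 + c' * F3"
      using linear_form_nonzero[of u v] by (metis mult_left_cancel)
    then have "p - q \<in> I" unfolding memI by blast
    then show "x = y" by (simp add: p q coset_eq_iff[OF I])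
  qed
  have surj': "(\<lambda>a. ?c ?l \<otimes>\<^bsub>poly3_ring Quot I\<^esub> a) ` quot_component I i = quot_component I (i + 1)"
    if "n' \<le> i + 2" for i
  proof
    show "(\<lambda>a. ?c ?l \<otimes>\<^bsub>poly3_ring Quot I\<^esub> a) ` quot_component I i \<subseteq> quot_component I (i + 1)"
    proof
      fix x assume "x \<in> (\<lambda>a. ?c ?l \<otimes>\<^bsub>poly3_ring Quot I\<^esub> a) ` quot_component I i"
      then obtain p where p: "homog 0 i p" "x = ?c (?l * p)"
        unfolding quot_component_def by (auto simp: forms_iff_homog coset_mult[OF I])
      have "homog 0 (i + 1) (?l * p)" using homog_mult[OF homog_linear_form p(1), of u v] by simp
      then show "x \<in> quot_component I (i + 1)"
        unfolding quot_component_def p(2) by (auto simp: forms_iff_homog)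
    qed
    show "quot_component I (i + 1) \<subseteq> (\<lambda>a. ?c ?l \<otimes>\<^bsub>poly3_ring Quot I\<^esub> a) ` quot_component I i"
    proof
      fix x assume "x \<in> quot_component I (i + 1)"
      then obtain h where h: "homog 0 (i + 1) h" "x = ?c h"
        unfolding quot_component_def by (auto simp: forms_iff_homog)
      have "line_surj (i + 2) d1 d2 d3 (on_line u v F1) (on_line u v F2) (on_line u v F3)"
        using line_surj_mono[OF n(1) surj that] .
      moreover have "deg_less 0 (i + 2) (on_line u v h)" using deg_less_on_line[OF h(1)] by simp
      ultimately obtain g1 g2 g3 where g: "deg_less d1 (i + 2) g1" "deg_less d2 (i + 2) g2" "deg_less d3 (i + 2) g3"
        "on_line u v h = g1 * on_line u v F1 + g2 * on_line u v F2 + g3 * on_line u v F3"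
        unfolding line_surj_def by blast
      obtain G1 G2 G3 where G: "homog d1 (i + 1) G1" "on_line u v G1 = g1"
        "homog d2 (i + 1) G2" "on_line u v G2 = g2" "homog d3 (i + 1) G3" "on_line u v G3 = g3"
        using ex_on_line[of _ "i + 1" _ u v] g(1-3) by (metis add_2_eq_Suc' Suc_eq_plus1)
      \<comment> \<open>The solution on the line is lifted to an element of \<open>I\<close>; it
        differs from \<open>h\<close> by a form vanishing on the line, hence by a multiple of
        \<open>?l\<close>.\<close>
      let ?s = "G1 * F1 + G2 * F2 + G3 * F3"
      have "homog 0 (i + 1) (h - ?s)"
        by (intro homog_diff homog_add homog_mult_form[OF G(1) F(1)] homog_mult_form[OF G(3) F(2)]
          homog_mult_form[OF G(5) F(3)] h(1))
      moreover have "on_line u v (h - ?s) = 0"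
        by (simp add: L.hom_minus L.hom_add L.hom_mult G g(4))
      ultimately obtain H where H: "homog (Suc 0) (i + 1) H" "h - ?s = ?l * H"
        by (rule on_line_eq_0_imp)
      have "homog 0 i H" using H(1) homog_shift[of 0 1 i H] by simp
      moreover have "?c h = ?c (?l * H)"
        unfolding coset_eq_iff[OF I] memI H(2)[symmetric] by (intro exI[of _ G1] exI[of _ G2] exI[of _ G3]) simp
      ultimately show "x \<in> (\<lambda>a. ?c ?l \<otimes>\<^bsub>poly3_ring Quot I\<^esub> a) ` quot_component I i"
        by (intro image_eqI[where x="?c H"])
          (simp_all add: h(2) coset_mult[OF I] quot_component_def forms_iff_homog)
    qed
  qed
  have "?c ?l \<in> quot_component I 1"
    unfolding quot_component_def by (rule imageI) (simp only: forms_iff_homog homog_linear_form)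
  moreover have "i + 2 \<le> n \<or> n' \<le> i + 2" for i using n(2) by linarith
  ultimately show ?thesis
    unfolding weak_lefschetz_property_def using inj' surj' by blast
qed

section \<open>Coprimality and syzygies of regular sequences\<close>

text \<open>Only homogeneous cofactors \<open>h\<close> are tested, so that coprimality can be
  proved by induction on their degree.\<close>

definition form_coprime :: "'k::field_char_0 poly3 \<Rightarrow> 'k poly3 \<Rightarrow> bool" where
  "form_coprime A B \<longleftrightarrow> (\<forall>n h. homog 0 n h \<longrightarrow> A dvd B * h \<longrightarrow> A dvd h)"

lemma ex_tdeg_less: "\<exists>N. tdeg_less d N h"
proof (induction h arbitrary: d)
  case (pCons c h)
  obtain N where N: "tdeg_less (Suc d) N h" using pCons.IH by blast
  have "deg_less d (max N (Suc (degree c + d))) c" by (simp add: deg_less_iff less_max_iff_disj)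
  moreover have "tdeg_less (Suc d) (max N (Suc (degree c + d))) h"
    using N unfolding tdeg_less_def by (meson less_max_iff_disj)
  ultimately show ?case unfolding tdeg_less_pCons by blast
qed simp

lemma tdeg_less_mono: "tdeg_less d N h \<Longrightarrow> N \<le> N' \<Longrightarrow> tdeg_less d N' h"
  unfolding tdeg_less_def by (meson less_le_trans)

lemma dehom_coprime:
  assumes F: "homog 0 d1 F1" "homog 0 d2 F2" and cop: "form_coprime F1 F2"
    and dvd: "dehom F1 dvd dehom F2 * h"
  shows "dehom F1 dvd h"
proof -
  obtain q where q: "dehom F2 * h = dehom F1 * q" using dvd by (elim dvdE)
  obtain N N' where "tdeg_less 0 N h" "tdeg_less 0 N' q" using ex_tdeg_less by blast
  \<comment> \<open>The degrees are enlarged so that \<open>F2 * H\<close> and \<open>F1 * Q\<close>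
    become forms of the same degree.\<close>
  then have "tdeg_less 0 (Suc (N + N' + d1)) h" "tdeg_less 0 (Suc (N + N' + d2)) q"
    by (auto elim: tdeg_less_mono)
  then obtain H Q where H: "homog 0 (N + N' + d1) H" "dehom H = h"
    and Q: "homog 0 (N + N' + d2) Q" "dehom Q = q"
    using ex_dehom by metis
  have "F2 * H = F1 * Q"
  proof (rule dehom_inj)
    show "homog (0 + 0) (d2 + (N + N' + d1)) (F2 * H)" by (rule homog_mult[OF F(2) H(1)])
    show "homog (0 + 0) (d2 + (N + N' + d1)) (F1 * Q)"
      using homog_mult[OF F(1) Q(1)] by (simp add: ac_simps)
    show "dehom (F2 * H) = dehom (F1 * Q)" by (simp add: dehom_mult H Q q)
  qed
  then have "F1 dvd F2 * H" by simp
  then have "F1 dvd H" using cop H(1) unfolding form_coprime_def by blast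
  then show ?thesis using H(2) by (metis dehom_mult dvd_def)
qed

text \<open>If both degrees dropped, \<open>y\<close> would divide both forms,
  \<open>F1 = y * A\<close> and \<open>F2 = y * B\<close>. Then \<open>F2 * A = F1 * B\<close>, so
  \<open>F1\<close> would divide the form \<open>A\<close> of smaller degree.\<close>

lemma dehom_coprime_degree:
  assumes F: "homog 0 d1 F1" "homog 0 d2 F2" and d: "0 < d1" "0 < d2"
    and cop: "form_coprime F1 F2" and F1: "F1 \<noteq> 0"
  shows "\<not> (tdeg_less 0 d1 (dehom F1) \<and> tdeg_less 0 d2 (dehom F2))"
proof
  assume b: "tdeg_less 0 d1 (dehom F1) \<and> tdeg_less 0 d2 (dehom F2)"
  obtain e1 e2 where e: "d1 = Suc e1" "d2 = Suc e2" using d by (metis Suc_pred)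
  obtain A where A: "homog 0 e1 A" "dehom A = dehom F1" using b ex_dehom[of 0 e1 "dehom F1"] e by metis
  obtain B where B: "homog 0 e2 B" "dehom B = dehom F2" using b ex_dehom[of 0 e2 "dehom F2"] e by metis
  define y :: "'a poly3" where "y = Poly_Mapping.single (Poly_Mapping.single 1 1) 1"
  have y: "homog 0 1 y" unfolding y_def by (rule homog_single) (simp add: total_degree_eq lookup_single)
  have dy: "dehom y = 1" by (simp add: y_def dehom_single lookup_single monom_0 pCons_one)
  have F1A: "F1 = y * A"
    by (rule dehom_inj[OF F(1)]) (use homog_mult[OF y A(1)] in \<open>simp_all add: e dehom_mult dy A\<close>)
  have F2B: "F2 = y * B"
    by (rule dehom_inj[OF F(2)]) (use homog_mult[OF y B(1)] in \<open>simp_all add: e dehom_mult dy B\<close>)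
  have "F2 * A = F1 * B" by (simp add: F1A F2B ac_simps)
  then have "F1 dvd F2 * A" by simp
  then have "F1 dvd A" using cop A(1) unfolding form_coprime_def by blast
  then have "A = 0" using homog_dvd_less[OF A(1) F(1)] e by simp
  then show False using F1A F1 by simp
qed

text \<open>Homogeneous version of \<open>generic_line\<close>: the strict bound
  \<open>Suc m\<close> on affine degrees corresponds to forms of degree \<open>m\<close>.\<close>

lemma ex_good_line:
  fixes F1 F2 F3 :: "'k::field_char_0 poly3"
  assumes F: "homog 0 d1 F1" "homog 0 d2 F2" "homog 0 d3 F3" and d: "0 < d1" "0 < d2"
    and n: "d1 \<le> Suc m" "d2 \<le> Suc m" "d3 \<le> Suc m" "d1 + d2 + d3 = 2 * Suc m"
    and cop: "form_coprime F1 F2" and F1: "F1 \<noteq> 0"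
    and nosyz: "\<And>G1 G2 G3. homog d1 m G1 \<Longrightarrow> homog d2 m G2 \<Longrightarrow> homog d3 m G3 \<Longrightarrow>
      G1 * F1 + G2 * F2 + G3 * F3 = 0 \<Longrightarrow> G1 = 0 \<and> G2 = 0 \<and> G3 = 0"
  obtains u v where
    "line_inj (Suc m) d1 d2 d3 (on_line u v F1) (on_line u v F2) (on_line u v F3)"
    "line_surj (Suc m) d1 d2 d3 (on_line u v F1) (on_line u v F2) (on_line u v F3)"
proof -
  interpret D: comm_ring_hom "dehom :: 'k poly3 \<Rightarrow> _" by (rule dehom_hom)
  have dF1: "dehom F1 \<noteq> 0" using dehom_eq_0_imp[OF F(1)] F1 by blast
  have nosyz': "H1 = 0 \<and> H2 = 0 \<and> H3 = 0"
    if H: "tdeg_less d1 (Suc m) H1" "tdeg_less d2 (Suc m) H2" "tdeg_less d3 (Suc m) H3"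
      "H1 * dehom F1 + H2 * dehom F2 + H3 * dehom F3 = 0" for H1 H2 H3
  proof -
    obtain G1 where G1: "homog d1 m G1" "dehom G1 = H1" using H(1) by (rule ex_dehom)
    obtain G2 where G2: "homog d2 m G2" "dehom G2 = H2" using H(2) by (rule ex_dehom)
    obtain G3 where G3: "homog d3 m G3" "dehom G3 = H3" using H(3) by (rule ex_dehom)
    have "homog 0 m (G1 * F1 + G2 * F2 + G3 * F3)"
      by (intro homog_add homog_mult_form[OF G1(1) F(1)] homog_mult_form[OF G2(1) F(2)]
          homog_mult_form[OF G3(1) F(3)])
    moreover have "dehom (G1 * F1 + G2 * F2 + G3 * F3) = 0"
      by (simp add: dehom_add dehom_mult G1 G2 G3 H(4))
    ultimately have "G1 * F1 + G2 * F2 + G3 * F3 = 0" by (rule dehom_eq_0_imp)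
    then have "G1 = 0 \<and> G2 = 0 \<and> G3 = 0" by (rule nosyz[OF G1(1) G2(1) G3(1)])
    then show ?thesis using G1(2) G2(2) G3(2) by auto
  qed
  obtain u v where uv: "syz_det (Suc m) d1 d2 (on_line u v F1) (on_line u v F2) (on_line u v F3) \<noteq> 0"
    unfolding on_line_def
    using generic_line[OF n tdeg_less_dehom[OF F(1)] tdeg_less_dehom[OF F(2)] tdeg_less_dehom[OF F(3)] dF1
      dehom_coprime[OF F(1,2) cop] dehom_coprime_degree[OF F(1,2) d cop F1] nosyz'] by blast
  note b = deg_less_on_line[OF F(1), of u v] deg_less_on_line[OF F(2), of u v] deg_less_on_line[OF F(3), of u v]
  show thesis
  proof
    show "line_inj (Suc m) d1 d2 d3 (on_line u v F1) (on_line u v F2) (on_line u v F3)"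
      unfolding line_inj_def using syz_det_nonzero_inj[OF n b uv] by blast
    show "line_surj (Suc m) d1 d2 d3 (on_line u v F1) (on_line u v F2) (on_line u v F3)"
      unfolding line_surj_def using syz_det_nonzero_surj[OF n b uv] by metis
  qed
qed

lemma homog_offset_cases:
  assumes "homog d n G"
  obtains "G = 0" | "d \<le> n" "homog 0 (n - d) G"
proof (cases "d \<le> n")
  case True
  then show thesis using that(2) assms homog_shift[of 0 d "n - d" G] by simp
next
  case False
  then show thesis using that(1) homog_less_imp_zero[OF assms] by simp
qed

lemma homog_combination_2:
  assumes "homog 0 d1 F1" "homog 0 d2 F2" "homog 0 n h" "h = a * F1 + b * F2"
  obtains a' b' where "homog d1 n a'" "homog d2 n b'" "h = a' * F1 + b' * F2"
proof -
  have h: "h = a * F1 + b * F2 + 0 * 0" using assms(4) by simp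
  obtain a' b' c' where "homog d1 n a'" "homog d2 n b'" "h = a' * F1 + b' * F2 + c' * 0"
    using homog_combination[OF assms(1,2) homog_0[of 0 0] assms(3) h] by blast
  then show thesis using that by simp
qed

text \<open>Coprimality makes \<open>G2\<close> a multiple of \<open>F1\<close>, but its degree
  \<open>m - d2\<close> is below \<open>d1\<close>.\<close>

lemma no_small_syzygy_2:
  assumes F: "homog 0 d1 F1" and F1: "F1 \<noteq> 0" and cop: "form_coprime F1 F2"
    and n: "m < d1 + d2" and G: "homog d1 m G1" "homog d2 m G2" "G1 * F1 + G2 * F2 = 0"
  shows "G1 = 0 \<and> G2 = 0"
proof -
  have "G2 = 0"
    using G(2)
  proof (cases rule: homog_offset_cases)
    case 2
    have "F2 * G2 = F1 * (- G1)" using G(3) by (simp add: algebra_simps eq_neg_iff_add_eq_0)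
    then have "F1 dvd F2 * G2" by simp
    then have "F1 dvd G2" using cop 2 unfolding form_coprime_def by blast
    then show ?thesis using homog_dvd_less[OF 2(2) F] n 2(1) by simp
  qed
  then show ?thesis using G(3) F1 by simp
qed

text \<open>Below the degrees of the Koszul syzygies: \<open>G3\<close> lies in the ideal of
  \<open>F1\<close> and \<open>F2\<close> but has degree less than \<open>d1\<close> and
  \<open>d2\<close>, so it vanishes and two forms remain.\<close>

lemma no_small_syzygy_3:
  assumes F: "homog 0 d1 F1" "homog 0 d2 F2" and F1: "F1 \<noteq> 0" and cop: "form_coprime F1 F2"
    and nzd: "\<And>g. \<exists>a b. F3 * g = a * F1 + b * F2 \<Longrightarrow> \<exists>a b. g = a * F1 + b * F2"
    and n: "m < d1 + d2" "m < d1 + d3" "m < d2 + d3"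
    and G: "homog d1 m G1" "homog d2 m G2" "homog d3 m G3" "G1 * F1 + G2 * F2 + G3 * F3 = 0"
  shows "G1 = 0 \<and> G2 = 0 \<and> G3 = 0"
proof -
  have "G3 = 0"
    using G(3)
  proof (cases rule: homog_offset_cases)
    case 2
    have "F3 * G3 = (- G1) * F1 + (- G2) * F2" using G(4) by (simp add: algebra_simps eq_neg_iff_add_eq_0)
    then obtain a b where "G3 = a * F1 + b * F2" using nzd by blast
    then obtain a b where "homog d1 (m - d3) a" "homog d2 (m - d3) b" "G3 = a * F1 + b * F2"
      using homog_combination_2[OF F 2(2)] by metis
    then show ?thesis using homog_less_imp_zero[of d1 "m - d3" a] homog_less_imp_zero[of d2 "m - d3" b] n 2(1)
      by simp
  qed
  then show ?thesis using no_small_syzygy_2[OF F(1) F1 cop n(1) G(1,2)] G(4) by simp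
qed

lemma coprime_swap:
  fixes A B :: "'a::idom"
  assumes "A \<noteq> 0" "\<And>g. A dvd B * g \<Longrightarrow> A dvd g" "B dvd A * h"
  shows "B dvd h"
proof -
  obtain k where k: "A * h = B * k" using assms(3) by (elim dvdE)
  then have "A dvd B * k" by (metis dvd_triv_left)
  then obtain k' where "k = A * k'" using assms(2) by blast
  then have "A * h = A * (B * k')" using k by (simp add: ac_simps)
  then show ?thesis using assms(1) by simp
qed

text \<open>A case of permuting a homogeneous regular sequence. If \<open>A dvd C * h\<close>, then
  \<open>h = a * A + b * B\<close> by \<open>nzd\<close>; cancelling \<open>B\<close> gives
  \<open>A dvd C * b\<close>, and \<open>b\<close> has smaller degree than \<open>h\<close> because
  \<open>0 < q\<close>.\<close>

lemma form_coprime_third: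
  assumes F: "homog 0 p A" "homog 0 q B" and q: "0 < q"
    and cop: "\<And>g. A dvd B * g \<Longrightarrow> A dvd g"
    and nzd: "\<And>g. \<exists>a b. C * g = a * A + b * B \<Longrightarrow> \<exists>a b. g = a * A + b * B"
  shows "form_coprime A C"
  unfolding form_coprime_def
proof (intro allI impI)
  fix n h assume "homog 0 n h" "A dvd C * h"
  then show "A dvd h"
  proof (induction n arbitrary: h rule: less_induct)
    case (less n)
    obtain k where k: "C * h = A * k" using less.prems(2) by (elim dvdE)
    then have "C * h = k * A + 0 * B" by simp
    then obtain a b where "h = a * A + b * B" using nzd by blast
    then obtain a b where b: "homog q n b" "h = a * A + b * B"
      using homog_combination_2[OF F less.prems(1)] by metis
    have "A dvd b"
      using b(1)
    proof (cases rule: homog_offset_cases)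
      case 2
      have "B * (C * b) = A * (k - C * a)" using k unfolding b(2) by (simp add: algebra_simps)
      then have "A dvd B * (C * b)" by simp
      then have "A dvd C * b" by (rule cop)
      then show ?thesis using less.IH[OF _ 2(2)] q 2(1) by simp
    qed simp
    then show ?case unfolding b(2) by simp
  qed
qed

section \<open>The ranges of degrees\<close>

text \<open>The third form is replaced by zero with nominal degree \<open>p + q\<close>, which makes
  the bound \<open>Suc m\<close> equal to \<open>p + q\<close> and the third block of columns empty.
  As \<open>r\<close> is larger still, the multiplier of \<open>C\<close> also vanishes below this
  bound, and the line conditions carry over to \<open>C\<close>.\<close>

lemma wlp_large_degree:
  fixes A B C :: "'k::field_char_0 poly3"
  assumes F: "homog 0 p A" "homog 0 q B" "homog 0 r C" and d: "0 < p" "0 < q"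
    and cop: "form_coprime A B" and A: "A \<noteq> 0" and r: "p + q < r"
  shows "weak_lefschetz_property (poly3_ring Quot (Idl\<^bsub>poly3_ring\<^esub> {A, B, C}))
    (quot_component (Idl\<^bsub>poly3_ring\<^esub> {A, B, C}))"
proof -
  obtain m where m: "p + q = Suc m" using d by (metis Suc_pred add_gr_0)
  have nosyz: "G1 = 0 \<and> G2 = 0 \<and> G3 = 0"
    if G: "homog p m G1" "homog q m G2" "homog (p + q) m G3" "G1 * A + G2 * B + G3 * 0 = 0" for G1 G2 G3
    using no_small_syzygy_2[OF F(1) A cop _ G(1,2)] G(4) homog_less_imp_zero[OF G(3)] m by simp
  have n: "p \<le> Suc m" "q \<le> Suc m" "p + q \<le> Suc m" "p + q + (p + q) = 2 * Suc m"
    using m by simp_all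
  obtain u v where uv: "line_inj (Suc m) p q (p + q) (on_line u v A) (on_line u v B) (on_line u v 0)"
    "line_surj (Suc m) p q (p + q) (on_line u v A) (on_line u v B) (on_line u v 0)"
    by (rule ex_good_line[OF F(1,2) homog_0 d n cop A nosyz])
  have z: "g = 0" if "deg_less d (Suc m) g" "Suc m \<le> d" for d and g :: "'k poly"
    using that by (auto simp: deg_less_iff)
  show ?thesis
  proof (rule wlp_if_line[OF F])
    show "line_inj (Suc m) p q r (on_line u v A) (on_line u v B) (on_line u v C)"
      unfolding line_inj_def
    proof (intro allI impI)
      fix g1 g2 g3
      assume g: "deg_less p (Suc m) g1" "deg_less q (Suc m) g2" "deg_less r (Suc m) g3"
        "g1 * on_line u v A + g2 * on_line u v B + g3 * on_line u v C = 0"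
      have g3: "g3 = 0" using z[OF g(3)] r m by simp
      then show "g1 = 0 \<and> g2 = 0 \<and> g3 = 0"
        using uv(1) g(1,2,4) deg_less_0 unfolding line_inj_def by (metis mult_zero_left)
    qed
    show "line_surj (Suc m) p q r (on_line u v A) (on_line u v B) (on_line u v C)"
      unfolding line_surj_def
    proof (intro allI impI)
      fix h :: "'k poly" assume "deg_less 0 (Suc m) h"
      then obtain g1 g2 g3 where g: "deg_less p (Suc m) g1" "deg_less q (Suc m) g2" "deg_less (p + q) (Suc m) g3"
        "h = g1 * on_line u v A + g2 * on_line u v B + g3 * on_line u v 0"
        using uv(2) unfolding line_surj_def by blast
      have "g3 = 0" using z[OF g(3)] m by simp
      then show "\<exists>g1 g2 g3. deg_less p (Suc m) g1 \<and> deg_less q (Suc m) g2 \<and> deg_less r (Suc m) g3 \<and>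
          h = g1 * on_line u v A + g2 * on_line u v B + g3 * on_line u v C"
        using g(1,2,4) deg_less_0 by (metis mult_zero_left)
    qed
  qed simp_all
qed

lemma wlp_even:
  fixes F1 F2 F3 :: "'k::field_char_0 poly3"
  assumes F: "homog 0 d1 F1" "homog 0 d2 F2" "homog 0 d3 F3" and d: "0 < d1" "0 < d2"
    and n: "d1 \<le> Suc m" "d2 \<le> Suc m" "d3 \<le> Suc m" "d1 + d2 + d3 = 2 * Suc m"
    and F1: "F1 \<noteq> 0" and cop: "form_coprime F1 F2"
    and nzd: "\<And>g. \<exists>a b. F3 * g = a * F1 + b * F2 \<Longrightarrow> \<exists>a b. g = a * F1 + b * F2"
  shows "weak_lefschetz_property (poly3_ring Quot (Idl\<^bsub>poly3_ring\<^esub> {F1, F2, F3}))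
    (quot_component (Idl\<^bsub>poly3_ring\<^esub> {F1, F2, F3}))"
proof -
  \<comment> \<open>Any two degrees sum to \<open>2 * Suc m\<close> minus the third, hence to at
    least \<open>Suc m\<close>.\<close>
  have m: "m < d1 + d2" "m < d1 + d3" "m < d2 + d3" using n by arith+
  obtain u v where
    "line_inj (Suc m) d1 d2 d3 (on_line u v F1) (on_line u v F2) (on_line u v F3)"
    "line_surj (Suc m) d1 d2 d3 (on_line u v F1) (on_line u v F2) (on_line u v F3)"
    by (rule ex_good_line[OF F d n cop F1 no_small_syzygy_3[OF F(1,2) F1 cop nzd m]])
  then show ?thesis by (intro wlp_if_line[OF F, of "Suc m" "Suc m"]) simp_all
qed

text \<open>Replacing \<open>F3\<close> by \<open>F3 * x\<close> makes the degree sum even. Going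
  back to \<open>F3\<close> costs one step on the injective side only, and \<open>n = m\<close>,
  \<open>n' = Suc m\<close> still satisfy the hypothesis of \<open>wlp_if_line\<close>.\<close>

lemma wlp_odd:
  fixes F1 F2 F3 :: "'k::field_char_0 poly3"
  assumes F: "homog 0 d1 F1" "homog 0 d2 F2" "homog 0 d3 F3" and d: "0 < d1" "0 < d2"
    and n: "d1 \<le> m" "d2 \<le> m" "d3 \<le> m" "d1 + d2 + d3 = Suc (2 * m)"
    and F1: "F1 \<noteq> 0" and cop: "form_coprime F1 F2"
    and nzd: "\<And>g. \<exists>a b. F3 * g = a * F1 + b * F2 \<Longrightarrow> \<exists>a b. g = a * F1 + b * F2"
  shows "weak_lefschetz_property (poly3_ring Quot (Idl\<^bsub>poly3_ring\<^esub> {F1, F2, F3}))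
    (quot_component (Idl\<^bsub>poly3_ring\<^esub> {F1, F2, F3}))"
proof -
  have m: "m < d1 + d2" "m < d1 + d3" "m < d2 + d3" using n by linarith+
  define x :: "'k poly3" where "x = Poly_Mapping.single (Poly_Mapping.single 0 1) 1"
  have x: "homog 0 1 x" unfolding x_def by (rule homog_single) (simp add: total_degree_eq lookup_single)
  have lx: "on_line u v x = [:0, 1:]" for u v
    by (simp add: on_line_def x_def dehom_single lookup_single monom_0 monom_altdef)
  have x0: "x \<noteq> 0" unfolding x_def by (metis lookup_single_eq lookup_zero zero_neq_one)
  have F3x: "homog 0 (Suc d3) (F3 * x)" using homog_mult[OF F(3) x] by simp
  have nosyz: "G1 = 0 \<and> G2 = 0 \<and> G3 = 0"
    if G: "homog d1 m G1" "homog d2 m G2" "homog (Suc d3) m G3" "G1 * F1 + G2 * F2 + G3 * (F3 * x) = 0"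
    for G1 G2 G3
  proof -
    have "homog d3 m (G3 * x)"
      using homog_mult[OF G(3) x] homog_shift[of d3 1 m "G3 * x"] by simp
    moreover have "G1 * F1 + G2 * F2 + (G3 * x) * F3 = 0" using G(4) by (simp add: ac_simps)
    ultimately have "G1 = 0 \<and> G2 = 0 \<and> G3 * x = 0"
      using no_small_syzygy_3[OF F(1,2) F1 cop nzd m G(1,2)] by blast
    then show ?thesis using x0 by simp
  qed
  have n': "d1 \<le> Suc m" "d2 \<le> Suc m" "Suc d3 \<le> Suc m" "d1 + d2 + Suc d3 = 2 * Suc m"
    using n by simp_all
  obtain u v where
    uv: "line_inj (Suc m) d1 d2 (Suc d3) (on_line u v F1) (on_line u v F2) (on_line u v (F3 * x))"
    "line_surj (Suc m) d1 d2 (Suc d3) (on_line u v F1) (on_line u v F2) (on_line u v (F3 * x))"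
    by (rule ex_good_line[OF F(1,2) F3x d n' cop F1 nosyz])
  interpret L: comm_ring_hom "on_line u v" by (rule on_line_hom)
  show ?thesis
  proof (rule wlp_if_line[OF F])
    show "line_inj m d1 d2 d3 (on_line u v F1) (on_line u v F2) (on_line u v F3)"
      unfolding line_inj_def
    proof (intro allI impI)
      fix g1 g2 g3
      assume g: "deg_less d1 m g1" "deg_less d2 m g2" "deg_less d3 m g3"
        "g1 * on_line u v F1 + g2 * on_line u v F2 + g3 * on_line u v F3 = 0"
      have b: "deg_less d (Suc m) ([:0, 1:] * g)" if "deg_less d m g" for d and g :: "'k poly"
        using that by (intro deg_less_linear_mult) (simp add: deg_less_def)
      have "deg_less (Suc d3) (Suc m) g3" using g(3) by (simp add: deg_less_def)
      \<comment> \<open>Multiplying the syzygy by \<open>x\<close> and absorbing that factor into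
        the third polynomial gives a syzygy for \<open>F3 * x\<close>.\<close>
      moreover have "([:0, 1:] * g1) * on_line u v F1 + ([:0, 1:] * g2) * on_line u v F2
          + g3 * on_line u v (F3 * x) = [:0, 1:] * (g1 * on_line u v F1 + g2 * on_line u v F2 + g3 * on_line u v F3)"
        unfolding L.hom_mult lx by (simp only: distrib_left ac_simps)
      ultimately have "[:0, 1:] * g1 = 0 \<and> [:0, 1:] * g2 = 0 \<and> g3 = 0"
        using uv(1) b[OF g(1)] b[OF g(2)] unfolding line_inj_def g(4) mult_zero_right by blast
      then show "g1 = 0 \<and> g2 = 0 \<and> g3 = 0" by simp
    qed
    show "line_surj (Suc m) d1 d2 d3 (on_line u v F1) (on_line u v F2) (on_line u v F3)"
      unfolding line_surj_def
    proof (intro allI impI)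
      fix h :: "'k poly" assume "deg_less 0 (Suc m) h"
      then obtain g1 g2 g3 where g: "deg_less d1 (Suc m) g1" "deg_less d2 (Suc m) g2" "deg_less (Suc d3) (Suc m) g3"
        "h = g1 * on_line u v F1 + g2 * on_line u v F2 + g3 * on_line u v (F3 * x)"
        using uv(2) unfolding line_surj_def by blast
      \<comment> \<open>The factor \<open>x\<close> moves from the third polynomial into its
        multiplier.\<close>
      have "deg_less d3 (Suc m) ([:0, 1:] * g3)" using g(3) by (rule deg_less_linear_mult)
      moreover have "h = g1 * on_line u v F1 + g2 * on_line u v F2 + ([:0, 1:] * g3) * on_line u v F3"
        unfolding g(4) L.hom_mult lx by (simp only: ac_simps)
      ultimately show "\<exists>g1 g2 g3. deg_less d1 (Suc m) g1 \<and> deg_less d2 (Suc m) g2 \<and> deg_less d3 (Suc m) g3 \<and>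
          h = g1 * on_line u v F1 + g2 * on_line u v F2 + g3 * on_line u v F3"
        using g(1,2) by blast
    qed
  qed simp_all
qed

lemma regular_sequenceD:
  fixes F1 F2 F3 :: "'k::field_char_0 poly3"
  assumes "regular_sequence poly3_ring [F1, F2, F3]"
  shows "F1 \<noteq> 0" "\<And>g. F1 dvd F2 * g \<Longrightarrow> F1 dvd g"
    "\<And>g. \<exists>a b. F3 * g = a * F1 + b * F2 \<Longrightarrow> \<exists>a b. g = a * F1 + b * F2"
proof -
  have r: "[F1, F2, F3] ! i * g \<in> Idl\<^bsub>poly3_ring\<^esub> (set (take i [F1, F2, F3])) \<Longrightarrow>
      g \<in> Idl\<^bsub>poly3_ring\<^esub> (set (take i [F1, F2, F3]))" if "i < 3" for i g
    using assms that unfolding regular_sequence_def by simp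
  have "F1 * 1 \<in> {0} \<Longrightarrow> 1 \<in> {0 :: 'k poly3}" using r[of 0 1] by (simp add: genideal_empty)
  then show "F1 \<noteq> 0" by auto
  show "F1 dvd g" if "F1 dvd F2 * g" for g using r[of 1 g] that by (simp add: genideal_1)
  show "\<exists>a b. g = a * F1 + b * F2" if "\<exists>a b. F3 * g = a * F1 + b * F2" for g
  proof -
    have "F3 * g \<in> Idl\<^bsub>poly3_ring\<^esub> {F1, F2}" using that unfolding genideal_2 by blast
    then have "g \<in> Idl\<^bsub>poly3_ring\<^esub> {F1, F2}" using r[of 2 g] by (simp add: numeral_2_eq_2)
    then show ?thesis unfolding genideal_2 by blast
  qed
qed

theorem corollary2p4:
  fixes F1 F2 F3 :: "'k::field_char_0 poly3" and d1 d2 d3 :: nat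
  assumes "d1 > 0" and "d2 > 0" and "d3 > 0"
    and "F1 \<in> forms d1" and "F2 \<in> forms d2" and "F3 \<in> forms d3"
    and "regular_sequence poly3_ring [F1, F2, F3]"
  defines "I \<equiv> Idl\<^bsub>poly3_ring\<^esub> {F1, F2, F3}"
  shows "weak_lefschetz_property (poly3_ring Quot I) (quot_component I)"
proof -
  have F: "homog 0 d1 F1" "homog 0 d2 F2" "homog 0 d3 F3" using assms(4-6) by (simp_all add: forms_iff_homog)
  note reg = regular_sequenceD[OF assms(7)]
  have cop: "form_coprime F1 F2" unfolding form_coprime_def using reg(2) by blast
  \<comment> \<open>If \<open>F2\<close> were zero, \<open>F1\<close> would divide 1, impossible in
    positive degree. This is needed when \<open>F2\<close> takes the first place.\<close>
  have F2: "F2 \<noteq> 0"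
  proof
    assume "F2 = 0"
    then have "F1 dvd 1" using reg(2)[of 1] by simp
    moreover have "homog 0 0 (1 :: 'k poly3)" by (simp add: homog_def total_degree_eq)
    ultimately have "(1 :: 'k poly3) = 0" using homog_dvd_less F(1) assms(1) by blast
    then show False by simp
  qed
  consider "d1 + d2 < d3" | "d1 + d3 < d2" | "d2 + d3 < d1"
    | m where "d1 \<le> Suc m" "d2 \<le> Suc m" "d3 \<le> Suc m" "d1 + d2 + d3 = 2 * Suc m"
    | m where "d1 \<le> m" "d2 \<le> m" "d3 \<le> m" "d1 + d2 + d3 = Suc (2 * m)"
  proof -
    have "\<exists>m. d1 + d2 + d3 = 2 * Suc m \<or> d1 + d2 + d3 = Suc (2 * m)"
      \<comment> \<open>Positive degrees make the sum at least 3, so an even sum has half of the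
        form \<open>Suc m\<close>.\<close>
      using assms(1-3) by presburger
    then obtain m where m: "d1 + d2 + d3 = 2 * Suc m \<or> d1 + d2 + d3 = Suc (2 * m)" by blast
    show thesis
    proof (cases "d1 + d2 < d3 \<or> d1 + d3 < d2 \<or> d2 + d3 < d1")
      case True
      then show thesis using that(1-3) by blast
    next
      case False
      then have le: "d3 \<le> d1 + d2" "d2 \<le> d1 + d3" "d1 \<le> d2 + d3" by auto
      from m show thesis
      proof
        assume N: "d1 + d2 + d3 = 2 * Suc m"
        have "d1 \<le> Suc m" "d2 \<le> Suc m" "d3 \<le> Suc m" using N le by simp_all
        then show thesis using N by (rule that(4))
      next
        assume N: "d1 + d2 + d3 = Suc (2 * m)"
        have "d1 \<le> m" "d2 \<le> m" "d3 \<le> m" using N le by simp_all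
        then show thesis using N by (rule that(5))
      qed
    qed
  qed
  then show ?thesis
  proof cases
    case 1
    then show ?thesis unfolding I_def by (rule wlp_large_degree[OF F assms(1,2) cop reg(1)])
  next
    case 2
    have "form_coprime F1 F3" by (rule form_coprime_third[OF F(1,2) assms(2) reg(2,3)])
    from wlp_large_degree[OF F(1,3,2) assms(1,3) this reg(1) 2] show ?thesis
      unfolding I_def by (simp only: insert_commute)
  next
    case 3
    \<comment> \<open>With \<open>F1\<close> of large degree, \<open>F2\<close> and
      \<open>F3\<close> form the coprime pair; coprimality is obtained from the reordered sequence
      \<open>F2\<close>, \<open>F1\<close>, \<open>F3\<close>.\<close>
    have nzd: "\<exists>a b. g = a * F2 + b * F1" if "\<exists>a b. F3 * g = a * F2 + b * F1" for g
      using reg(3)[of g] that by (metis add.commute)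
    have "form_coprime F2 F3"
      by (rule form_coprime_third[OF F(2,1) assms(1) coprime_swap[OF reg(1,2)] nzd])
    from wlp_large_degree[OF F(2,3,1) assms(2,3) this F2 3] show ?thesis
      unfolding I_def by (simp only: insert_commute)
  next
    case (4 m)
    then show ?thesis unfolding I_def by (rule wlp_even[OF F assms(1,2) _ _ _ _ reg(1) cop reg(3)])
  next
    case (5 m)
    then show ?thesis unfolding I_def by (rule wlp_odd[OF F assms(1,2) _ _ _ _ reg(1) cop reg(3)])
  qed
qed

end
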